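(* Let $n\ge1$ and let $\alpha,\beta\in\mathbb C^n$ satisfy $\Re\alpha_j+\Re\beta_j>-1$ and $\alpha_j,\beta_j\notin\{-1,-2,\ldots\}$ for all $1\le j\le n$. For every $0<A<+\infty$ and $1\le B<\infty$ there is a constant $C=C_{\alpha,\beta,A,B}$ such that, for every complex Borel measure $\mu$ on $\mathbb T^n$, $$m_n\big(\{\eta\in\mathbb T^n:(M^{NT}_{A,B}\mu)(\eta)>\lambda\}\big)\le C\,\frac{\|\mu\|}{\lambda},\qquad\lambda>0.$$
   Context: $\mathbb D$ is the open unit disc and $\mathbb T$ the unit circle; $m_n$ is the normalized Haar measure on $\mathbb T^n$; $\|\mu\|=|\mu|(\mathbb T^n)$ is the total variation. The $(\alpha,\beta)$-Poisson kernel is, for $z\in\mathbb D^n$, $\zeta\in\mathbb T^n$ (principal branches of powers), $$P_{\alpha,\beta}(z,\zeta)=\prod_{j=1}^n c_{\alpha_j,\beta_j}\frac{(1-|z_j|^2)^{\alpha_j+\beta_j+1}}{(1-z_j\overline{\zeta_j})^{\alpha_j+1}(1-\overline{z_j}\zeta_j)^{\beta_j+1}},\qquad c_{a,b}=\frac{\Gamma(a+1)\Gamma(b+1)}{\Gamma(a+b+1)},$$ and $P_{\alpha,\beta}[d\mu](z)=\int_{\mathbb T^n}P_{\alpha,\beta}(z,\zeta)\,d\mu(\zeta)$, $z\in\mathbb D^n$. The Stolz region at $e^{i\varphi}\in\mathbb T$ is $S_A(e^{i\varphi})=\{re^{i(\varphi-\theta)}:0\le r<1,\ |\theta|\le A(1-r)\}$.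 For $\eta\in\mathbb T^n$, $S_A(\eta)=\prod_{j=1}^nS_A(\eta_j)$, and the restricted Stolz cone is $$S_{A,B}(\eta)=\Big\{(z_1,\ldots,z_n)\in S_A(\eta):\max_{j,k}\frac{1-|z_j|}{1-|z_k|}\le B\Big\}.$$ The restricted non-tangential maximal function of $\mu$ is $(M^{NT}_{A,B}\mu)(\eta)=\sup_{z\in S_{A,B}(\eta)}|P_{\alpha,\beta}[d\mu](z)|$, $\eta\in\mathbb T^n$. *)

theory Defs
  imports "HOL-Analysis.Analysis"
begin

section \<open>Complex measures\<close>

text \<open>A complex measure is a countably additive complex-valued set function on the
  \<sigma>-algebra of \<open>N\<close>; \<open>N\<close> only supplies the measurable space. Additivity on the constant
  sequence of empty sets already gives \<open>\<mu> {} = 0\<close>.\<close>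

definition complex_measure :: "'a measure \<Rightarrow> ('a set \<Rightarrow> complex) \<Rightarrow> bool" where
  "complex_measure N \<mu> \<longleftrightarrow>
     (\<forall>E::nat \<Rightarrow> 'a set. range E \<subseteq> sets N \<longrightarrow> disjoint_family E \<longrightarrow>
        (\<lambda>i. \<mu> (E i)) sums \<mu> (\<Union>i. E i))"

definition variation :: "'a measure \<Rightarrow> ('a set \<Rightarrow> complex) \<Rightarrow> 'a set \<Rightarrow> ennreal" where
  "variation N \<mu> X =
     (SUP E\<in>{E::nat \<Rightarrow> 'a set. range E \<subseteq> sets N \<and> disjoint_family E \<and> (\<Union>i. E i) = X}.
        \<Sum>i. ennreal (norm (\<mu> (E i))))"

definition total_variation :: "'a measure \<Rightarrow> ('a set \<Rightarrow> complex) \<Rightarrow> ennreal" where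
  "total_variation N \<mu> = variation N \<mu> (space N)"

text \<open>The positive part \<open>\<nu>\<^sup>+(X) = sup {\<nu> F | F \<subseteq> X}\<close> of the Jordan decomposition of a real
  signed measure \<open>\<nu>\<close>; the negative part is the positive part of \<open>-\<nu>\<close>. Here \<open>ennreal\<close> sends
  negative reals to 0, which does not affect the supremum since \<open>F = {}\<close> contributes 0.\<close>

definition pos_part_measure :: "'a measure \<Rightarrow> ('a set \<Rightarrow> real) \<Rightarrow> 'a measure" where
  "pos_part_measure N \<nu> =
     measure_of (space N) (sets N) (\<lambda>X. SUP F\<in>{F\<in>sets N. F \<subseteq> X}. ennreal (\<nu> F))"

definition complex_measure_integral ::
    "'a measure \<Rightarrow> ('a set \<Rightarrow> complex) \<Rightarrow> ('a \<Rightarrow> complex) \<Rightarrow> complex" where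
  "complex_measure_integral N \<mu> f =
     ((LINT x|pos_part_measure N (\<lambda>X. Re (\<mu> X)). f x)
        - (LINT x|pos_part_measure N (\<lambda>X. - Re (\<mu> X)). f x))
     + \<i> * ((LINT x|pos_part_measure N (\<lambda>X. Im (\<mu> X)). f x)
        - (LINT x|pos_part_measure N (\<lambda>X. - Im (\<mu> X)). f x))"


section \<open>The torus\<close>

definition torus :: "(complex ^ 'n) set" where
  "torus = {\<zeta>. \<forall>j. norm (\<zeta> $ j) = 1}"

definition torus_borel :: "(complex ^ 'n) measure" where
  "torus_borel = restrict_space borel torus"

text \<open>Normalised Haar measure, as the image of normalised Lebesgue measure on \<open>[0, 2\<pi>]\<^sup>n\<close>
  under \<open>t \<mapsto> (exp (\<i> t\<^sub>1), \<dots>, exp (\<i> t\<^sub>n))\<close>.\<close>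

definition torus_haar :: "(complex ^ 'n) measure" where
  "torus_haar =
     distr (uniform_measure lborel (cbox (0 :: real ^ 'n) (\<chi> j. 2 * pi)))
       torus_borel (\<lambda>t. \<chi> j. cis (t $ j))"


section \<open>Poisson kernels and the restricted non-tangential maximal function\<close>

text \<open>On complex numbers \<open>powr\<close> is the principal branch.\<close>

definition poisson_const :: "complex \<Rightarrow> complex \<Rightarrow> complex" where
  "poisson_const a b = Gamma (a + 1) * Gamma (b + 1) / Gamma (a + b + 1)"

definition poisson_kernel ::
    "complex ^ 'n \<Rightarrow> complex ^ 'n \<Rightarrow> complex ^ 'n \<Rightarrow> complex ^ 'n \<Rightarrow> complex" where
  "poisson_kernel \<alpha> \<beta> z \<zeta> =
     (\<Prod>j\<in>UNIV. poisson_const (\<alpha> $ j) (\<beta> $ j) *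
        (complex_of_real (1 - (norm (z $ j))\<^sup>2) powr (\<alpha> $ j + \<beta> $ j + 1) /
          ((1 - z $ j * cnj (\<zeta> $ j)) powr (\<alpha> $ j + 1) *
           (1 - cnj (z $ j) * \<zeta> $ j) powr (\<beta> $ j + 1))))"

definition poisson_integral ::
    "complex ^ 'n \<Rightarrow> complex ^ 'n \<Rightarrow> ((complex ^ 'n) set \<Rightarrow> complex) \<Rightarrow> complex ^ 'n \<Rightarrow> complex" where
  "poisson_integral \<alpha> \<beta> \<mu> z =
     complex_measure_integral torus_borel \<mu> (\<lambda>\<zeta>. poisson_kernel \<alpha> \<beta> z \<zeta>)"

text \<open>With \<open>\<eta> = exp (\<i> \<phi>)\<close>, the point \<open>r exp (\<i> (\<phi> - \<theta>))\<close> is \<open>r \<eta> exp (-\<i> \<theta>)\<close>.\<close>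

definition stolz :: "real \<Rightarrow> complex \<Rightarrow> complex set" where
  "stolz A \<eta> = {of_real r * \<eta> * cis (- \<theta>) | r \<theta>. 0 \<le> r \<and> r < 1 \<and> \<bar>\<theta>\<bar> \<le> A * (1 - r)}"

definition restricted_stolz :: "real \<Rightarrow> real \<Rightarrow> complex ^ 'n \<Rightarrow> (complex ^ 'n) set" where
  "restricted_stolz A B \<eta> =
     {z. (\<forall>j. z $ j \<in> stolz A (\<eta> $ j)) \<and>
         (\<forall>j k. (1 - norm (z $ j)) / (1 - norm (z $ k)) \<le> B)}"

text \<open>The supremum may be infinite, so it is taken in \<open>[0, \<infinity>]\<close>.\<close>

definition nt_maximal ::
    "complex ^ 'n \<Rightarrow> complex ^ 'n \<Rightarrow> real \<Rightarrow> real \<Rightarrow> ((complex ^ 'n) set \<Rightarrow> complex) \<Rightarrow>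
       complex ^ 'n \<Rightarrow> ennreal" where
  "nt_maximal \<alpha> \<beta> A B \<mu> \<eta> =
     (SUP z\<in>restricted_stolz A B \<eta>. ennreal (norm (poisson_integral \<alpha> \<beta> \<mu> z)))"

end

theory Submission
  imports Defs
begin

text \<open>Write \<open>s\<^sub>j = Re \<alpha>\<^sub>j + Re \<beta>\<^sub>j + 1 > 0\<close>. The imaginary parts of the exponents change the modulus of a
  principal power only by a bounded factor, and for \<open>z\<close> in the Stolz region at \<open>\<eta>\<close> one has
  \<open>\<bar>\<zeta>\<^sub>j - z\<^sub>j\<bar> \<ge> c max (1 - \<bar>z\<^sub>j\<bar>) \<bar>\<zeta>\<^sub>j - \<eta>\<^sub>j\<bar>\<close>. In the restricted cone all the numbers \<open>1 - \<bar>z\<^sub>j\<bar>\<close> are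
  comparable to one scale \<open>h\<close>, so the kernel is at most a constant times
  \<open>\<Prod>j. h\<^sup>-\<^sup>1 (1 + \<bar>\<zeta>\<^sub>j - \<eta>\<^sub>j\<bar> / h) powr (- s\<^sub>j - 1)\<close>.

  This product has no integrable radial majorant when some \<open>s\<^sub>j\<close> is small, so it is cut up dyadically in
  each coordinate separately (\<open>norm_poisson_kernel_dyadic_le\<close>): if \<open>\<bar>\<zeta>\<^sub>j - \<eta>\<^sub>j\<bar>\<close> is about \<open>2^k\<^sub>j h\<close>, the
  kernel is at most \<open>\<Prod>j. 2 powr (- s\<^sub>j k\<^sub>j)\<close> times the reciprocal of the volume of the polydisc with radii
  \<open>2^k\<^sub>j h\<close>. For a fixed multi-index \<open>k\<close> these polydiscs are the dilates of one shape by the single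
  parameter \<open>h\<close>; therefore the Vitali covering argument applies, and the maximal function of the averages
  over them is of weak type (1,1) with a constant that does not depend on \<open>k\<close>
  (\<open>weak_type_polydisc_maximal\<close>). This is the point where the restriction of the cone enters: for
  rectangles with independent side lengths the maximal function is not of weak type (1,1).

  Weak type bounds cannot simply be added over infinitely many \<open>k\<close>. Instead the level for the index
  \<open>k\<close> is raised by \<open>\<Prod>j. q\<^sub>j powr (- k\<^sub>j)\<close> with \<open>q\<^sub>j = 2 powr (- s\<^sub>j / 2)\<close>. This spends half of the decay
  of the kernel and leaves the other half, so that both the sum of the exceptional sets and the sum of the
  kernel pieces off these sets are geometric series (\<open>weak_type_positive_measure\<close>).

  A complex measure enters through the four positive and negative parts of its real and imaginary part,
  each of which has mass at most the total variation. The superlevel sets of the maximal function are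
  relatively open, since the cone at \<open>\<eta>\<close> is the cone at \<open>(1, \<dots>, 1)\<close> rotated by \<open>\<eta>\<close> and each rotated
  Poisson integral is continuous in \<open>\<eta>\<close> (\<open>nt_maximal_superlevel_measurable\<close>).\<close>

section \<open>Complex measures and their positive and negative parts\<close>

lemma complex_measure_empty:
  assumes "complex_measure N \<mu>"
  shows "\<mu> {} = 0"
proof -
  have "(\<lambda>i::nat. \<mu> {}) sums \<mu> {}"
    using assms[unfolded complex_measure_def, rule_format, of "\<lambda>_. {}"]
    by (auto simp: disjoint_family_on_def)
  then show ?thesis
    by (metis sums_summable summable_const_iff)
qed

lemma complex_measure_Un:
  assumes "complex_measure N \<mu>" "X \<in> sets N" "Y \<in> sets N" "X \<inter> Y = {}"
  shows "\<mu> (X \<union> Y) = \<mu> X + \<mu> Y"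
proof -
  have "(\<lambda>i. \<mu> (binaryset X Y i)) sums \<mu> (\<Union>i. binaryset X Y i)"
    using assms
    by (intro assms(1)[unfolded complex_measure_def, rule_format])
       (auto simp: disjoint_family_on_def binaryset_def)
  moreover have "(\<lambda>i. \<mu> (binaryset X Y i)) sums (\<mu> X + \<mu> Y)"
    by (rule binaryset_sums) (rule complex_measure_empty[OF assms(1)])
  ultimately show ?thesis
    using sums_unique2 by (fastforce simp: UN_binaryset_eq)
qed

text \<open>Call a set unbounded if \<open>\<mu>\<close> is unbounded on its measurable subsets. An unbounded set \<open>E\<close> contains a set
  \<open>F\<close> with \<open>\<bar>\<mu> F\<bar> > \<bar>\<mu> E\<bar> + 1\<close>, whence also \<open>\<bar>\<mu> (E - F)\<bar> \<ge> 1\<close>, and one of \<open>F\<close>, \<open>E - F\<close> is again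
  unbounded. Iteration splits off infinitely many disjoint sets of measure at least 1 in modulus, and
  the series of their measures cannot converge. Finiteness of the mass is what later allows dominated
  convergence with constant majorants.\<close>

lemma complex_measure_bounded:
  assumes \<mu>: "complex_measure N \<mu>"
  shows "\<exists>K. \<forall>F\<in>sets N. norm (\<mu> F) \<le> K"
proof (rule ccontr)
  define unb where "unb E \<longleftrightarrow> E \<in> sets N \<and> (\<forall>K. \<exists>F\<in>sets N. F \<subseteq> E \<and> norm (\<mu> F) > K)" for E
  assume "\<not> ?thesis"
  then have top: "unb (space N)"
    unfolding unb_def by (metis sets.top sets.sets_into_space not_le)
  have step: "\<exists>A. unb A \<and> A \<subseteq> E \<and> norm (\<mu> (E - A)) \<ge> 1" if E: "unb E" for E
  proof -
    have EN: "E \<in> sets N" using E by (simp add: unb_def)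
    obtain F where F: "F \<in> sets N" "F \<subseteq> E" "norm (\<mu> F) > norm (\<mu> E) + 1"
      using E unfolding unb_def by blast
    have "\<mu> E = \<mu> F + \<mu> (E - F)"
      using complex_measure_Un[OF \<mu>, of F "E - F"] F EN by (simp add: Un_absorb1)
    then have big: "norm (\<mu> (E - F)) \<ge> 1"
      using F(3) by (metis add.commute add_diff_cancel norm_triangle_ineq2 norm_minus_commute
        le_diff_eq less_eq_real_def order_trans)
    have "unb F \<or> unb (E - F)"
    proof (rule ccontr)
      assume "\<not> (unb F \<or> unb (E - F))"
      then obtain K L where K: "\<And>G. G \<in> sets N \<Longrightarrow> G \<subseteq> F \<Longrightarrow> norm (\<mu> G) \<le> K"
        and L: "\<And>G. G \<in> sets N \<Longrightarrow> G \<subseteq> E - F \<Longrightarrow> norm (\<mu> G) \<le> L"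
        unfolding unb_def using F EN by (meson not_le sets.Diff)
      obtain G where G: "G \<in> sets N" "G \<subseteq> E" "norm (\<mu> G) > K + L"
        using E unfolding unb_def by blast
      have "G = (G \<inter> F) \<union> (G - F)" by blast
      then have "\<mu> G = \<mu> (G \<inter> F) + \<mu> (G - F)"
        using complex_measure_Un[OF \<mu>, of "G \<inter> F" "G - F"] G F by auto
      then have "norm (\<mu> G) \<le> K + L"
        using K[of "G \<inter> F"] L[of "G - F"] G F norm_triangle_ineq[of "\<mu> (G \<inter> F)" "\<mu> (G - F)"]
        by (auto simp: Diff_mono)
      with G show False by simp
    qed
    moreover have "E - (E - F) = F" using F by blast
    moreover have "norm (\<mu> F) \<ge> 1" using F norm_ge_zero[of "\<mu> E"] by linarith
    ultimately show ?thesis using F big by (metis Diff_subset)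
  qed
  obtain E where E: "\<And>n::nat. unb (E n)" "\<And>n. E (Suc n) \<subseteq> E n \<and> norm (\<mu> (E n - E (Suc n))) \<ge> 1"
    using dependent_nat_choice[of "\<lambda>_ E. unb E" "\<lambda>_ E A. A \<subseteq> E \<and> norm (\<mu> (E - A)) \<ge> 1"]
      top step by metis
  have dec: "decseq E" using E(2) by (simp add: decseq_Suc_iff)
  have "disjoint_family (\<lambda>n. E n - E (Suc n))"
    unfolding disjoint_family_on_def
  proof (intro ballI impI)
    fix m n :: nat assume "m \<noteq> n"
    then consider "Suc m \<le> n" | "Suc n \<le> m" by linarith
    then show "(E m - E (Suc m)) \<inter> (E n - E (Suc n)) = {}"
      using decseqD[OF dec, of "Suc m" n] decseqD[OF dec, of "Suc n" m] by cases blast+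
  qed
  moreover have "range (\<lambda>n. E n - E (Suc n)) \<subseteq> sets N"
    using E(1) by (auto simp: unb_def)
  ultimately have "(\<lambda>n. \<mu> (E n - E (Suc n))) sums \<mu> (\<Union>n. E n - E (Suc n))"
    using \<mu> unfolding complex_measure_def by blast
  then have "(\<lambda>n. \<mu> (E n - E (Suc n))) \<longlonglongrightarrow> 0"
    by (intro summable_LIMSEQ_zero sums_summable)
  then obtain n where "norm (\<mu> (E n - E (Suc n))) < 1"
    unfolding LIMSEQ_iff by (metis diff_zero le_refl zero_less_one)
  with E(2)[of n] show False by simp
qed

text \<open>The partition of the whole space into \<open>F\<close>, its complement and empty sets competes in the supremum
  that defines the total variation.\<close>

lemma norm_le_total_variation:
  assumes \<mu>: "complex_measure N \<mu>" and F: "F \<in> sets N"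
  shows "ennreal (norm (\<mu> F)) \<le> total_variation N \<mu>"
proof -
  let ?E = "binaryset F (space N - F)"
  have sub: "F \<subseteq> space N" using F by (rule sets.sets_into_space)
  have "ennreal (norm (\<mu> F)) = ennreal (norm (\<mu> (?E 0)))" by (simp add: binaryset_def)
  also have "\<dots> \<le> (\<Sum>i. ennreal (norm (\<mu> (?E i))))"
    using sum_le_suminf[OF summableI, of "{0::nat}" "\<lambda>i. ennreal (norm (\<mu> (?E i)))"]
    by (simp only: finite.intros sum.insert sum.empty empty_iff not_False_eq_True add_0_right zero_le if_True simp_thms)
  also have "\<dots> \<le> total_variation N \<mu>"
    unfolding total_variation_def variation_def
    by (rule SUP_upper) (use F sub in \<open>auto simp: disjoint_family_on_def binaryset_def\<close>)
  finally show ?thesis .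
qed

lemma sets_pos_part_measure [simp]: "sets (pos_part_measure N \<nu>) = sets N"
  unfolding pos_part_measure_def by (simp add: sets.space_closed sets.sigma_sets_eq)

lemma space_pos_part_measure [simp]: "space (pos_part_measure N \<nu>) = space N"
  by (rule sets_eq_imp_space_eq) simp

text \<open>The constructor \<open>measure_of\<close> yields either the given set function or the zero measure, so the upper bound
  follows without constructing the Jordan decomposition.\<close>

lemma pos_part_measure_le:
  assumes "\<And>F. F \<in> sets N \<Longrightarrow> ennreal (\<nu> F) \<le> K"
  shows "emeasure (pos_part_measure N \<nu>) X \<le> K"
  unfolding pos_part_measure_def emeasure_measure_of_conv
  using assms by (auto intro!: SUP_least)

text \<open>To be used with \<open>g\<close> equal to \<open>Re\<close>, \<open>- Re\<close>, \<open>Im\<close> and \<open>- Im\<close>.\<close>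

lemma pos_part_measure_mass:
  assumes \<mu>: "complex_measure N \<mu>" and g: "\<And>w. g w \<le> norm w"
  shows "finite_measure (pos_part_measure N (\<lambda>X. g (\<mu> X)))"
    and "emeasure (pos_part_measure N (\<lambda>X. g (\<mu> X))) X \<le> total_variation N \<mu>"
proof -
  have le: "ennreal (g (\<mu> F)) \<le> ennreal (norm (\<mu> F))" for F
    using g by (rule ennreal_leI)
  obtain K where K: "\<And>F. F \<in> sets N \<Longrightarrow> norm (\<mu> F) \<le> K"
    using complex_measure_bounded[OF \<mu>] by blast
  have "emeasure (pos_part_measure N (\<lambda>X. g (\<mu> X))) (space N) \<le> ennreal K"
    by (rule pos_part_measure_le) (meson K le ennreal_leI order_trans)
  then show "finite_measure (pos_part_measure N (\<lambda>X. g (\<mu> X)))"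
    by (intro finite_measureI) (auto simp: top_unique)
  show "emeasure (pos_part_measure N (\<lambda>X. g (\<mu> X))) X \<le> total_variation N \<mu>"
    by (rule pos_part_measure_le) (meson le norm_le_total_variation[OF \<mu>] order_trans)
qed

text \<open>This holds also if \<open>f\<close> is not integrable: the Bochner integral is then 0 by convention.\<close>

lemma norm_lebesgue_integral_le_nn_integral:
  fixes f :: "'a \<Rightarrow> complex"
  shows "ennreal (norm (LINT x|M. f x)) \<le> (\<integral>\<^sup>+x. ennreal (norm (f x)) \<partial>M)"
  by (cases "integrable M f") (auto intro: integral_norm_bound_ennreal simp: not_integrable_integral_eq)

section \<open>Haar measure of polydiscs in the torus\<close>

text \<open>Up to \<open>\<pi>/3\<close> the derivative \<open>cos\<close> is at least \<open>1/2\<close>; beyond that \<open>sin u\<close> is at least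
  \<open>sin (\<pi>/3) > \<pi>/4\<close>.\<close>

lemma sin_ge_half:
  assumes "0 \<le> u" "u \<le> pi/2"
  shows "sin u \<ge> u / 2"
proof (cases "u \<le> pi/3")
  case True
  show ?thesis
  proof (cases "u = 0")
    case False
    then have "0 < u" using assms by simp
    then obtain \<xi> where \<xi>: "0 < \<xi>" "\<xi> < u" "sin u - sin 0 = (u - 0) * cos \<xi>"
      using MVT2[of 0 u sin cos] by (auto intro: DERIV_sin)
    have "cos (pi/3) \<le> cos \<xi>"
      by (rule cos_monotone_0_pi_le) (use \<xi> True assms in auto)
    then have "u * (1/2) \<le> u * cos \<xi>"
      using \<open>0 < u\<close> by (intro mult_left_mono) (auto simp: cos_60)
    then show ?thesis using \<xi>(3) by simp
  qed simp
next
  case False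
  have "sin (pi/3) \<le> sin u"
    by (rule sin_monotone_2pi_le) (use False assms in auto)
  moreover have "17/10 \<le> sqrt 3" by (rule real_le_rsqrt) (simp add: power2_eq_square)
  moreover have "pi < 32/10" using pi_approx by simp
  ultimately show ?thesis using assms by (simp add: sin_60)
qed

lemma cis_dist_sin: "norm (cis t - cis \<phi>) = 2 * \<bar>sin ((t - \<phi>) / 2)\<bar>"
proof -
  have "(norm (cis t - cis \<phi>))\<^sup>2 = (cos t - cos \<phi>)\<^sup>2 + (sin t - sin \<phi>)\<^sup>2"
    by (simp add: cmod_power2)
  also have "\<dots> = 2 - 2 * (cos t * cos \<phi> + sin t * sin \<phi>)"
    using sin_cos_squared_add[of t] sin_cos_squared_add[of \<phi>]
    unfolding power2_diff by argo
  also have "\<dots> = 2 - 2 * cos (2 * ((t - \<phi>)/2))"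
    by (simp only: cos_diff[symmetric] mult_2 field_sum_of_halves)
  also have "\<dots> = (2 * \<bar>sin ((t - \<phi>) / 2)\<bar>)\<^sup>2"
    unfolding cos_double_sin by (simp add: power_mult_distrib)
  finally show ?thesis by (subst (asm) power2_eq_iff_nonneg) auto
qed

text \<open>Chordal and angular distance are comparable once the angle \<open>t - \<phi>\<close>, which lies between \<open>-2\<pi>\<close> and
  \<open>2\<pi>\<close>, has been reduced modulo \<open>2\<pi>\<close>.\<close>

lemma cis_dist_lower:
  assumes "0 \<le> t" "t \<le> 2*pi" "0 \<le> \<phi>" "\<phi> \<le> 2*pi" and d: "norm (cis t - cis \<phi>) < \<delta>"
  shows "\<exists>e\<in>{-1,0,1::real}. \<bar>t - \<phi> - 2 * pi * e\<bar> \<le> 2 * \<delta>"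
proof -
  obtain e :: real where e: "e \<in> {-1,0,1}" "\<bar>t - \<phi> - 2 * pi * e\<bar> \<le> pi"
  proof (cases "t - \<phi> > pi")
    case True then show ?thesis using assms by (intro that[of 1]) auto
  next
    case F: False
    show ?thesis
    proof (cases "t - \<phi> < - pi")
      case True then show ?thesis using assms by (intro that[of "-1"]) auto
    next
      case False then show ?thesis using F by (intro that[of 0]) auto
    qed
  qed
  define y where "y = t - \<phi> - 2 * pi * e"
  have y: "(t - \<phi>)/2 = y/2 + pi * e" by (simp add: y_def field_simps)
  have "\<bar>sin ((t - \<phi>)/2)\<bar> = \<bar>sin (y/2)\<bar>"
    unfolding y using e(1) by (auto simp: sin_diff sin_add)
  also have "\<dots> = \<bar>sin (\<bar>y\<bar>/2)\<bar>" by (cases "y \<ge> 0") auto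
  also have "\<dots> \<ge> \<bar>y\<bar> / 4"
    using sin_ge_half[of "\<bar>y\<bar>/2"] e(2) by (simp add: y_def)
  finally have "\<bar>y\<bar> \<le> 2 * \<delta>" using d unfolding cis_dist_sin by simp
  then show ?thesis using e(1) unfolding y_def by blast
qed

lemma space_torus_borel [simp]: "space torus_borel = torus"
  by (simp add: torus_borel_def space_restrict_space)

lemma sets_torus_haar [simp]: "sets torus_haar = sets torus_borel"
  by (simp add: torus_haar_def)

lemma torus_Int_open: "open U \<Longrightarrow> torus \<inter> U \<in> sets torus_borel"
  unfolding torus_borel_def sets_restrict_space by (rule imageI) (rule borel_open)

lemma cis_vec_measurable:
  "(\<lambda>t::real^'n. \<chi> j. cis (t $ j)) \<in> measurable borel torus_borel"
  unfolding torus_borel_def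
proof (rule measurable_restrict_space2)
  show "(\<lambda>t::real^'n. \<chi> j. cis (t $ j)) \<in> measurable borel borel"
  proof (rule borel_measurable_continuous_onI)
    show "continuous_on UNIV (\<lambda>t::real^'n. \<chi> j. cis (t $ j))"
      by (intro continuous_on_vec_lambda continuous_on_cis continuous_intros)
  qed
  show "(\<lambda>t::real^'n. \<chi> j. cis (t $ j)) \<in> space borel \<rightarrow> torus"
    by (simp add: torus_def)
qed

definition polydisc :: "('n \<Rightarrow> real) \<Rightarrow> complex ^ 'n \<Rightarrow> (complex ^ 'n) set" where
  "polydisc \<delta> \<eta> = {\<zeta>. \<forall>j. norm (\<zeta> $ j - \<eta> $ j) < \<delta> j}"

lemma open_polydisc: "open (polydisc \<delta> (\<eta> :: complex ^ 'n))"
proof -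
  have "polydisc \<delta> \<eta> = (\<Inter>j::'n. {\<zeta>. norm (\<zeta> $ j - \<eta> $ j) < \<delta> j})"
    by (auto simp: polydisc_def)
  also have "open \<dots>" by (intro open_INT ballI open_Collect_less continuous_intros) auto
  finally show ?thesis .
qed

text \<open>In angular coordinates the polydisc is covered by \<open>3^n\<close> boxes with side lengths \<open>4 \<delta>\<^sub>j\<close>, one for each
  choice of the multiples of \<open>2\<pi>\<close> in the coordinates; the normalisation divides by \<open>(2\<pi>)^n\<close>, and
  \<open>3 * 4 / (2\<pi>) = 6/\<pi>\<close>.\<close>

lemma torus_haar_polydisc_le:
  fixes \<eta> :: "complex ^ 'n"
  assumes \<eta>: "\<eta> \<in> torus" and \<delta>: "\<And>j. \<delta> j \<ge> 0"
  shows "emeasure torus_haar (torus \<inter> polydisc \<delta> \<eta>) \<le> ennreal ((6/pi) ^ CARD('n) * (\<Prod>j\<in>UNIV. \<delta> j))"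
proof -
  have "\<exists>\<phi>. 0 \<le> \<phi> \<and> \<phi> \<le> 2*pi \<and> \<eta> $ j = cis \<phi>" for j
  proof (intro exI conjI)
    have "norm (\<eta> $ j) = 1" using \<eta> by (simp add: torus_def)
    then show "\<eta> $ j = cis (Arg2pi (\<eta> $ j))"
      by (metis Arg2pi_eq cis_conv_exp mult_1 of_real_1)
  qed (use Arg2pi_ge_0[of "\<eta> $ j"] Arg2pi_lt_2pi[of "\<eta> $ j"] in auto)
  then obtain \<phi> where \<phi>: "\<And>j. 0 \<le> \<phi> j" "\<And>j. \<phi> j \<le> 2*pi" "\<And>j. \<eta> $ j = cis (\<phi> j)" by metis
  define Q where "Q = cbox (0::real^'n) (\<chi> j. 2*pi)"
  define T where "T = (UNIV :: 'n set) \<rightarrow>\<^sub>E {-1,0,1::real}"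
  define box where "box e = cbox (\<chi> j. \<phi> j + 2*pi*e j - 2 * \<delta> j) (\<chi> j. \<phi> j + 2*pi*e j + 2 * \<delta> j)" for e :: "'n \<Rightarrow> real"
  let ?c = "\<lambda>t::real^'n. \<chi> j. cis (t $ j)"
  have finT: "finite T" unfolding T_def by (intro finite_PiE) auto
  have cardT: "card T = 3 ^ CARD('n)" unfolding T_def by (subst card_PiE) (auto simp: numeral_3_eq_3)
  have Qm: "emeasure lborel Q = ennreal ((2*pi) ^ CARD('n))"
  proof -
    have "measure lborel Q = (2*pi) ^ CARD('n)"
      unfolding Q_def by (subst content_cbox_cart) (auto simp: interval_eq_empty_cart not_less)
    then show ?thesis
      unfolding Q_def by (subst emeasure_eq_ennreal_measure) (auto simp: emeasure_lborel_cbox_eq)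
  qed
  have boxm: "emeasure lborel (box e) = ennreal (4 ^ CARD('n) * (\<Prod>j\<in>UNIV. \<delta> j))" for e
  proof -
    have "measure lborel (box e) = (\<Prod>j\<in>(UNIV::'n set). 4 * \<delta> j)"
      unfolding box_def by (subst content_cbox_cart) (auto simp: interval_eq_empty_cart not_less \<delta>)
    then show ?thesis
      unfolding box_def
      by (subst emeasure_eq_ennreal_measure) (auto simp: emeasure_lborel_cbox_eq prod.distrib)
  qed
  have sub: "Q \<inter> (?c -` (torus \<inter> polydisc \<delta> \<eta>)) \<subseteq> (\<Union>e\<in>T. box e)"
  proof
    fix t assume t: "t \<in> Q \<inter> (?c -` (torus \<inter> polydisc \<delta> \<eta>))"
    have "\<exists>e\<in>{-1,0,1::real}. \<bar>t $ j - \<phi> j - 2 * pi * e\<bar> \<le> 2 * \<delta> j" for j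
    proof (rule cis_dist_lower)
      show "0 \<le> t $ j" "t $ j \<le> 2 * pi" using t by (auto simp: Q_def mem_box_cart)
      show "norm (cis (t $ j) - cis (\<phi> j)) < \<delta> j"
        using t unfolding polydisc_def \<phi>(3)[symmetric] by auto
    qed (fact \<phi>)+
    then obtain e where e: "\<And>j. e j \<in> {-1,0,1::real}" "\<And>j. \<bar>t $ j - \<phi> j - 2 * pi * e j\<bar> \<le> 2 * \<delta> j"
      by metis
    then have "e \<in> T" "t \<in> box e"
      by (auto simp: T_def box_def mem_box_cart abs_le_iff algebra_simps)
    then show "t \<in> (\<Union>e\<in>T. box e)" by blast
  qed
  have meas: "torus \<inter> polydisc \<delta> \<eta> \<in> sets torus_borel"
    by (rule torus_Int_open[OF open_polydisc])
  have "emeasure torus_haar (torus \<inter> polydisc \<delta> \<eta>)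
      = emeasure (uniform_measure lborel Q) (?c -` (torus \<inter> polydisc \<delta> \<eta>))"
    unfolding torus_haar_def Q_def
  proof (subst emeasure_distr)
    show "?c \<in> measurable (uniform_measure lborel (cbox 0 (\<chi> j. 2 * pi))) torus_borel"
      using cis_vec_measurable by (simp cong: measurable_cong_sets)
  qed (use meas in auto)
  also have "\<dots> = emeasure lborel (Q \<inter> (?c -` (torus \<inter> polydisc \<delta> \<eta>))) / emeasure lborel Q"
    by (subst emeasure_uniform_measure)
       (use measurable_sets[OF cis_vec_measurable meas] in \<open>auto simp: Q_def\<close>)
  also have "\<dots> \<le> (\<Sum>e\<in>T. emeasure lborel (box e)) / emeasure lborel Q"
  proof (rule divide_right_mono_ennreal)
    have "emeasure lborel (Q \<inter> (?c -` (torus \<inter> polydisc \<delta> \<eta>))) \<le> emeasure lborel (\<Union>e\<in>T. box e)"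
      by (rule emeasure_mono[OF sub]) (auto simp: box_def finT)
    also have "\<dots> \<le> (\<Sum>e\<in>T. emeasure lborel (box e))"
      by (rule emeasure_subadditive_finite) (auto simp: box_def finT)
    finally show "emeasure lborel (Q \<inter> (?c -` (torus \<inter> polydisc \<delta> \<eta>))) \<le> (\<Sum>e\<in>T. emeasure lborel (box e))" .
  qed
  also have "\<dots> = ennreal ((6/pi) ^ CARD('n) * (\<Prod>j\<in>UNIV. \<delta> j))"
  proof -
    have "(\<Sum>e\<in>T. emeasure lborel (box e)) = ennreal (3 ^ CARD('n) * (4 ^ CARD('n) * (\<Prod>j\<in>UNIV. \<delta> j)))"
      by (simp add: boxm cardT ennreal_mult' ennreal_power[symmetric] prod_nonneg \<delta>)
    moreover have "3 ^ CARD('n) * (4 ^ CARD('n) * (\<Prod>j\<in>UNIV. \<delta> j)) / (2*pi) ^ CARD('n)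
        = (6/pi) ^ CARD('n) * (\<Prod>j\<in>UNIV. \<delta> j)"
    proof -
      have "(6/pi) ^ CARD('n) = ((3 * 4) / (2 * pi)) ^ CARD('n)" by simp
      also have "\<dots> = 3 ^ CARD('n) * 4 ^ CARD('n) / (2*pi) ^ CARD('n)"
        by (simp only: power_divide power_mult_distrib)
      finally show ?thesis by simp
    qed
    ultimately show ?thesis
      unfolding Qm by (simp add: divide_ennreal prod_nonneg \<delta>)
  qed
  finally show ?thesis .
qed

section \<open>Averages over polydiscs of a fixed shape\<close>

text \<open>Greedy selection: keep an element of maximal radius, discard everything that meets it, and repeat.
  Whatever is discarded lies in the enlargement \<open>Y\<close> of the element that it meets.\<close>

lemma finite_Vitali_selection:
  fixes r :: "'i \<Rightarrow> real"
  assumes "finite I"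
    and "\<forall>i\<in>I. \<forall>m\<in>I. r i \<le> r m \<longrightarrow> X i \<inter> X m \<noteq> {} \<longrightarrow> X i \<subseteq> Y m"
  shows "\<exists>J\<subseteq>I. disjoint_family_on X J \<and> (\<Union>i\<in>I. X i) \<subseteq> (\<Union>j\<in>J. Y j)"
  using assms
proof (induction I rule: finite_psubset_induct)
  case (psubset I)
  show ?case
  proof (cases "I = {}")
    case False
    obtain m where m: "m \<in> I" "\<And>i. i \<in> I \<Longrightarrow> r i \<le> r m"
    proof -
      have "Max (r ` I) \<in> r ` I" using psubset.hyps False by (intro Max_in) auto
      then obtain m where m: "m \<in> I" "r m = Max (r ` I)" by (metis imageE)
      have "r i \<le> r m" if "i \<in> I" for i
        unfolding m(2) using psubset.hyps that by (intro Max_ge) auto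
      with m(1) show ?thesis by (rule that)
    qed
    let ?I = "{i \<in> I - {m}. X i \<inter> X m = {}}"
    have "?I \<subset> I" using m(1) by blast
    moreover have "\<forall>i\<in>?I. \<forall>m\<in>?I. r i \<le> r m \<longrightarrow> X i \<inter> X m \<noteq> {} \<longrightarrow> X i \<subseteq> Y m"
      using psubset.prems by blast
    ultimately have "\<exists>J\<subseteq>?I. disjoint_family_on X J \<and> (\<Union>i\<in>?I. X i) \<subseteq> (\<Union>j\<in>J. Y j)"
      by (rule psubset.IH)
    then obtain J where J: "J \<subseteq> ?I" "disjoint_family_on X J" "(\<Union>i\<in>?I. X i) \<subseteq> (\<Union>j\<in>J. Y j)"
      by (elim exE conjE)
    have "disjoint_family_on X (insert m J)"
      unfolding disjoint_family_on_def
    proof (intro ballI impI)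
      fix a b assume "a \<in> insert m J" "b \<in> insert m J" "a \<noteq> b"
      then consider "a \<in> J" "b \<in> J" | "a = m" "b \<in> J" | "a \<in> J" "b = m" by blast
      then show "X a \<inter> X b = {}"
      proof cases
        case 1 with J(2) \<open>a \<noteq> b\<close> show ?thesis unfolding disjoint_family_on_def by blast
      next
        case 2 with J(1) show ?thesis by blast
      next
        case 3 with J(1) show ?thesis by blast
      qed
    qed
    moreover have "X i \<subseteq> (\<Union>j\<in>insert m J. Y j)" if "i \<in> I" for i
    proof (cases "i \<in> ?I")
      case True
      with J(3) show ?thesis by blast
    next
      case False
      show ?thesis
      proof (cases "X i = {}")
        case False
        have "X i \<inter> X m \<noteq> {}" using False \<open>i \<notin> ?I\<close> \<open>i \<in> I\<close> by blast
        then have "X i \<subseteq> Y m" using psubset.prems m \<open>i \<in> I\<close> by metis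
        then show ?thesis by blast
      qed simp
    qed
    ultimately show ?thesis using J(1) m(1)
      by (intro exI[of _ "insert m J"] conjI UN_least) blast+
  qed (simp add: disjoint_family_on_def)
qed

lemma polydisc_subset_triple:
  fixes \<eta> \<xi> :: "complex ^ 'n"
  assumes "\<And>j. d j \<ge> 0" "h \<le> k"
    and "polydisc (\<lambda>j. d j * h) \<eta> \<inter> polydisc (\<lambda>j. d j * k) \<xi> \<noteq> {}"
  shows "polydisc (\<lambda>j. d j * h) \<eta> \<subseteq> polydisc (\<lambda>j. 3 * (d j * k)) \<xi>"
proof
  obtain \<omega> where \<omega>: "\<And>j. norm (\<omega> $ j - \<eta> $ j) < d j * h" "\<And>j. norm (\<omega> $ j - \<xi> $ j) < d j * k"
    using assms(3) by (auto simp: polydisc_def)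
  fix \<zeta> assume "\<zeta> \<in> polydisc (\<lambda>j. d j * h) \<eta>"
  then have \<zeta>: "norm (\<zeta> $ j - \<eta> $ j) < d j * h" for j by (auto simp: polydisc_def)
  have "norm (\<zeta> $ j - \<xi> $ j) < 3 * (d j * k)" for j
  proof -
    have "norm (\<zeta> $ j - \<xi> $ j) = norm ((\<zeta> $ j - \<eta> $ j) - (\<omega> $ j - \<eta> $ j) + (\<omega> $ j - \<xi> $ j))" by simp
    also have "\<dots> \<le> norm (\<zeta> $ j - \<eta> $ j) + norm (\<omega> $ j - \<eta> $ j) + norm (\<omega> $ j - \<xi> $ j)"
      by (meson add_right_mono norm_triangle_ineq norm_triangle_ineq4 order_trans)
    also have "\<dots> < d j * h + d j * h + d j * k" using \<zeta>[of j] \<omega>[of j] by linarith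
    also have "\<dots> \<le> 3 * (d j * k)" using mult_left_mono[OF assms(2) assms(1)[of j]] by linarith
    finally show ?thesis .
  qed
  then show "\<zeta> \<in> polydisc (\<lambda>j. 3 * (d j * k)) \<xi>" by (simp add: polydisc_def)
qed

text \<open>Vitali's argument. Countably many of the open polydiscs in which the average is large cover the set
  in question, by second countability, and its measure is approximated by finite subfamilies. In a finite
  subfamily the selected disjoint polydiscs have total measure at most \<open>\<nu> torus\<close>, while their threefold
  enlargements cover; enlarging by 3 turns the constant \<open>6/\<pi>\<close> of the Haar bound into \<open>18/\<pi>\<close>. Because
  the shape \<open>d\<close> is the same for all polydiscs and cancels, the constant does not depend on it.\<close>

lemma weak_type_polydisc_maximal:
  fixes \<nu> :: "(complex ^ 'n) measure"
  assumes sets: "sets \<nu> = sets torus_borel" and d: "\<And>j. d j > 0" and T: "T > 0"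
  shows "\<exists>U\<in>sets torus_haar.
      {\<eta> \<in> torus. \<exists>h>0. ennreal (T * (\<Prod>j\<in>UNIV. d j * h)) < emeasure \<nu> (torus \<inter> polydisc (\<lambda>j. d j * h) \<eta>)} \<subseteq> U \<and>
      emeasure torus_haar U \<le> ennreal ((18/pi) ^ CARD('n) / T) * emeasure \<nu> torus"
proof -
  define P where "P = {(\<eta>, h). \<eta> \<in> torus \<and> h > 0 \<and>
    ennreal (T * (\<Prod>j\<in>UNIV. d j * h)) < emeasure \<nu> (torus \<inter> polydisc (\<lambda>j. d j * h) \<eta>)}"
  define D where "D p = polydisc (\<lambda>j. d j * snd p) (fst p)" for p :: "(complex^'n) \<times> real"
  define X where "X p = torus \<inter> D p" for p
  define Y where "Y p = torus \<inter> polydisc (\<lambda>j. 3 * (d j * snd p)) (fst p)" for p :: "(complex^'n) \<times> real"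
  let ?K = "(18/pi) ^ CARD('n) / T"
  have Xs: "X p \<in> sets torus_borel" for p unfolding X_def D_def by (rule torus_Int_open[OF open_polydisc])
  have Ys: "Y p \<in> sets torus_borel" for p unfolding Y_def by (rule torus_Int_open[OF open_polydisc])
  have torus_s: "torus \<in> sets torus_borel" using torus_Int_open[OF open_UNIV] by simp
  have fin_bound: "emeasure torus_haar (\<Union>p\<in>I. X p) \<le> ennreal ?K * emeasure \<nu> torus"
    if I: "finite I" "I \<subseteq> P" for I
  proof -
    have "\<forall>p\<in>I. \<forall>q\<in>I. snd p \<le> snd q \<longrightarrow> X p \<inter> X q \<noteq> {} \<longrightarrow> X p \<subseteq> Y q"
    proof (intro ballI impI)
      fix p q assume "snd p \<le> snd q" "X p \<inter> X q \<noteq> {}"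
      then have "D p \<subseteq> polydisc (\<lambda>j. 3 * (d j * snd q)) (fst q)"
        unfolding D_def using d by (intro polydisc_subset_triple) (auto simp: X_def D_def less_imp_le)
      then show "X p \<subseteq> Y q" unfolding X_def Y_def by blast
    qed
    from finite_Vitali_selection[OF I(1) this]
    obtain J where J: "J \<subseteq> I" "disjoint_family_on X J" "(\<Union>p\<in>I. X p) \<subseteq> (\<Union>p\<in>J. Y p)" by blast
    have finJ: "finite J" using J(1) I(1) by (rule finite_subset)
    have Yb: "emeasure torus_haar (Y p) \<le> ennreal ?K * emeasure \<nu> (X p)" if "p \<in> J" for p
    proof -
      have p: "fst p \<in> torus" "snd p > 0"
        "ennreal (T * (\<Prod>j\<in>UNIV. d j * snd p)) < emeasure \<nu> (X p)"
        using that J(1) I(2) by (auto simp: P_def X_def D_def)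
      have "emeasure torus_haar (Y p) \<le> ennreal ((6/pi) ^ CARD('n) * (\<Prod>j\<in>UNIV. 3 * (d j * snd p)))"
        unfolding Y_def using p d by (intro torus_haar_polydisc_le) (auto simp: less_imp_le)
      also have "(6/pi) ^ CARD('n) * (\<Prod>j\<in>(UNIV::'n set). 3 * (d j * snd p)) = ?K * (T * (\<Prod>j\<in>UNIV. d j * snd p))"
      proof -
        have "(\<Prod>j\<in>(UNIV::'n set). 3 * (d j * snd p)) = 3 ^ CARD('n) * (\<Prod>j\<in>UNIV. d j * snd p)"
          by (subst prod.distrib) simp
        moreover have "(18/pi) ^ CARD('n) = ((6/pi) * 3) ^ CARD('n)" by simp
        ultimately show ?thesis using T by (simp only: power_mult_distrib) simp
      qed
      also have "ennreal (?K * (T * (\<Prod>j\<in>UNIV. d j * snd p))) = ennreal ?K * ennreal (T * (\<Prod>j\<in>UNIV. d j * snd p))"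
        using T by (intro ennreal_mult') simp
      also have "\<dots> \<le> ennreal ?K * emeasure \<nu> (X p)"
        using p(3) by (intro mult_left_mono) auto
      finally show ?thesis .
    qed
    have "emeasure torus_haar (\<Union>p\<in>I. X p) \<le> emeasure torus_haar (\<Union>p\<in>J. Y p)"
      using J(3) finJ Ys by (intro emeasure_mono) auto
    also have "\<dots> \<le> (\<Sum>p\<in>J. emeasure torus_haar (Y p))"
      using finJ Ys by (intro emeasure_subadditive_finite) auto
    also have "\<dots> \<le> (\<Sum>p\<in>J. ennreal ?K * emeasure \<nu> (X p))" by (intro sum_mono Yb)
    also have "\<dots> = ennreal ?K * (\<Sum>p\<in>J. emeasure \<nu> (X p))" by (simp add: sum_distrib_left)
    also have "(\<Sum>p\<in>J. emeasure \<nu> (X p)) = emeasure \<nu> (\<Union>p\<in>J. X p)"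
      using Xs finJ J(2) by (intro sum_emeasure) (auto simp: sets)
    also have "\<dots> \<le> emeasure \<nu> torus"
      using torus_s by (intro emeasure_mono) (auto simp: sets X_def)
    finally show ?thesis by (simp add: mult_left_mono)
  qed
  obtain F where F: "F \<subseteq> D ` P" "countable F" "\<Union>F = \<Union>(D ` P)"
    by (rule Lindelof[of "D ` P"]) (auto simp: D_def intro: open_polydisc)
  then obtain P0 where P0: "P0 \<subseteq> P" "countable P0" "F = D ` P0"
    using countable_subset_image[of F D P] by blast
  define U where "U = (\<Union>p\<in>P0. X p)"
  have "U \<in> sets torus_haar" unfolding U_def using P0(2) Xs by auto
  moreover have "{\<eta> \<in> torus. \<exists>h>0. ennreal (T * (\<Prod>j\<in>UNIV. d j * h)) < emeasure \<nu> (torus \<inter> polydisc (\<lambda>j. d j * h) \<eta>)} \<subseteq> U"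
  proof
    fix \<eta> assume "\<eta> \<in> {\<eta> \<in> torus. \<exists>h>0. ennreal (T * (\<Prod>j\<in>UNIV. d j * h)) < emeasure \<nu> (torus \<inter> polydisc (\<lambda>j. d j * h) \<eta>)}"
    then obtain h where "\<eta> \<in> torus" "(\<eta>, h) \<in> P" "h > 0" by (auto simp: P_def)
    then have "\<eta> \<in> D (\<eta>, h)" using d by (auto simp: D_def polydisc_def)
    then have "\<eta> \<in> \<Union>(D ` P0)" using F(3) P0(3) \<open>(\<eta>, h) \<in> P\<close> by blast
    then show "\<eta> \<in> U" using \<open>\<eta> \<in> torus\<close> by (auto simp: U_def X_def)
  qed
  moreover have "emeasure torus_haar U \<le> ennreal ?K * emeasure \<nu> torus"
  proof (cases "P0 = {}")
    case False
    obtain e :: "nat \<Rightarrow> _" where e: "P0 = range e"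
      using False P0(2) uncountable_def by metis
    have "U = (\<Union>m. \<Union>i<m. X (e i))"
      unfolding U_def e by auto
    also have "emeasure torus_haar \<dots> = (SUP m. emeasure torus_haar (\<Union>i<m. X (e i)))"
    proof (rule SUP_emeasure_incseq[symmetric])
      show "range (\<lambda>m. \<Union>i<m. X (e i)) \<subseteq> sets torus_haar" by (auto intro!: sets.finite_UN Xs)
      show "incseq (\<lambda>m. \<Union>i<m. X (e i))"
        by (rule incseq_SucI) (simp only: lessThan_Suc UN_insert Un_upper2)
    qed
    also have "\<dots> \<le> ennreal ?K * emeasure \<nu> torus"
    proof (rule SUP_least)
      fix m
      show "emeasure torus_haar (\<Union>i<m. X (e i)) \<le> ennreal ?K * emeasure \<nu> torus"
        using fin_bound[of "e ` {..<m}"] P0(1) unfolding e by (simp add: image_subset_iff)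
    qed
    finally show ?thesis .
  qed (simp add: U_def)
  ultimately show ?thesis by (intro bexI[of _ U] conjI)
qed

section \<open>Dyadic estimates of one factor of the kernel\<close>

definition poisson_factor :: "complex \<Rightarrow> complex \<Rightarrow> complex \<Rightarrow> complex \<Rightarrow> complex" where
  "poisson_factor a b z \<zeta> = poisson_const a b *
     (complex_of_real (1 - (norm z)\<^sup>2) powr (a + b + 1) /
       ((1 - z * cnj \<zeta>) powr (a + 1) * (1 - cnj z * \<zeta>) powr (b + 1)))"

text \<open>\<open>\<bar>w powr a\<bar> = \<bar>w\<bar> powr (Re a) * exp (- Im a * Arg w)\<close>, and the argument is at most \<open>\<pi>\<close> in
  modulus.\<close>

lemma norm_powr_ge:
  assumes "w \<noteq> 0"
  shows "norm w powr Re a * exp (- (pi * \<bar>Im a\<bar>)) \<le> norm (w powr a)"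
proof -
  have "Im a * Arg w \<le> \<bar>Im a\<bar> * \<bar>Arg w\<bar>" by (metis abs_ge_self abs_mult)
  also have "\<dots> \<le> \<bar>Im a\<bar> * pi"
    using Arg_bounded[of w] by (intro mult_left_mono) auto
  finally show ?thesis
    unfolding norm_powr_complex by (intro mult_left_mono) (auto simp: mult.commute)
qed

lemma norm_one_minus_mult_cnj:
  assumes "norm \<zeta> = 1"
  shows "norm (1 - z * cnj \<zeta>) = norm (\<zeta> - z)"
proof -
  have "1 - z * cnj \<zeta> = (\<zeta> - z) * cnj \<zeta>"
    using assms complex_norm_square[of \<zeta>] by (simp add: algebra_simps)
  then show ?thesis using assms by (simp add: norm_mult)
qed

lemma norm_poisson_factor_le:
  fixes a b :: complex
  defines "s \<equiv> Re a + Re b + 1"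
  assumes s: "s > 0" and z: "norm z < 1" and \<zeta>: "norm \<zeta> = 1"
  shows "norm (poisson_factor a b z \<zeta>) \<le>
    norm (poisson_const a b) * exp (pi * (\<bar>Im a\<bar> + \<bar>Im b\<bar>)) * 2 powr s *
      ((1 - norm z) powr s / norm (\<zeta> - z) powr (s + 1))"
proof -
  define w where "w = 1 - z * cnj \<zeta>"
  define m where "m = norm (\<zeta> - z)"
  have w: "norm w = m" unfolding w_def m_def by (rule norm_one_minus_mult_cnj[OF \<zeta>])
  have cw: "1 - cnj z * \<zeta> = cnj w" by (simp add: w_def)
  have m: "m > 0" using z \<zeta> by (auto simp: m_def)
  have "w \<noteq> 0" using w m by auto
  have num: "norm (complex_of_real (1 - (norm z)\<^sup>2) powr (a + b + 1)) \<le> 2 powr s * (1 - norm z) powr s"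
  proof -
    have pos: "1 - (norm z)\<^sup>2 > 0"
      using z by (simp add: abs_square_less_1)
    have "norm (complex_of_real (1 - (norm z)\<^sup>2) powr (a + b + 1)) = (1 - (norm z)\<^sup>2) powr s"
      using norm_powr_real_powr[of "complex_of_real (1 - (norm z)\<^sup>2)" "a + b + 1"] pos
      by (simp add: s_def)
    also have "\<dots> \<le> (2 * (1 - norm z)) powr s"
    proof (rule powr_mono2)
      have "(norm z - 1)\<^sup>2 \<ge> 0" by simp
      then show "1 - (norm z)\<^sup>2 \<le> 2 * (1 - norm z)" unfolding power2_diff by simp
    qed (use s pos in auto)
    also have "\<dots> = 2 powr s * (1 - norm z) powr s" using z by (intro powr_mult)
    finally show ?thesis .
  qed
  have den: "m powr (s + 1) * exp (- (pi * (\<bar>Im a\<bar> + \<bar>Im b\<bar>))) \<le>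
      norm (w powr (a + 1) * cnj w powr (b + 1))"
  proof -
    have "m powr (s + 1) * exp (- (pi * (\<bar>Im a\<bar> + \<bar>Im b\<bar>)))
      = (norm w powr Re (a + 1) * exp (- (pi * \<bar>Im (a + 1)\<bar>))) *
        (norm (cnj w) powr Re (b + 1) * exp (- (pi * \<bar>Im (b + 1)\<bar>)))"
      by (simp add: w s_def powr_add[symmetric] exp_add[symmetric] algebra_simps)
    also have "\<dots> \<le> norm (w powr (a + 1)) * norm (cnj w powr (b + 1))"
      using \<open>w \<noteq> 0\<close> by (intro mult_mono norm_powr_ge) auto
    finally show ?thesis by (simp add: norm_mult)
  qed
  have "norm (poisson_factor a b z \<zeta>) = norm (poisson_const a b) *
      (norm (complex_of_real (1 - (norm z)\<^sup>2) powr (a + b + 1)) / norm (w powr (a + 1) * cnj w powr (b + 1)))"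
    unfolding poisson_factor_def cw unfolding w_def[symmetric] by (simp add: norm_mult norm_divide)
  also have "\<dots> \<le> norm (poisson_const a b) *
      ((2 powr s * (1 - norm z) powr s) / (m powr (s + 1) * exp (- (pi * (\<bar>Im a\<bar> + \<bar>Im b\<bar>)))))"
    using m by (intro mult_left_mono frac_le num den) auto
  also have "\<dots> = norm (poisson_const a b) * exp (pi * (\<bar>Im a\<bar> + \<bar>Im b\<bar>)) * 2 powr s *
      ((1 - norm z) powr s / norm (\<zeta> - z) powr (s + 1))"
    by (simp only: exp_minus m_def divide_inverse inverse_mult_distrib inverse_inverse_eq mult_ac)
  finally show ?thesis .
qed

text \<open>A point of the Stolz region is no farther from its vertex than \<open>(1 + A) (1 - \<bar>z\<bar>)\<close>, and every point of
  the circle has distance at least \<open>1 - \<bar>z\<bar>\<close> from \<open>z\<close>.\<close>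

lemma stolz_dist_le:
  assumes z: "z \<in> stolz A \<eta>" and "norm \<eta> = 1" "norm \<zeta> = 1" "A \<ge> 0"
  shows "norm z < 1" "1 - norm z \<le> norm (\<zeta> - z)" "norm (\<zeta> - \<eta>) \<le> (2 + A) * norm (\<zeta> - z)"
proof -
  obtain r \<theta> where r: "z = of_real r * \<eta> * cis (- \<theta>)" "0 \<le> r" "r < 1" "\<bar>\<theta>\<bar> \<le> A * (1 - r)"
    using z by (auto simp: stolz_def)
  have nz: "norm z = r" using r assms(2) by (simp add: norm_mult)
  then show "norm z < 1" using r by simp
  show 1: "1 - norm z \<le> norm (\<zeta> - z)" using norm_triangle_ineq2[of \<zeta> z] assms(3) by simp
  have "z - \<eta> = \<eta> * (of_real r * (cis (-\<theta>) - 1) + of_real (r - 1))" by (simp add: r(1) algebra_simps)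
  then have "norm (z - \<eta>) \<le> norm (of_real r * (cis (-\<theta>) - 1)) + norm (complex_of_real (r - 1))"
    using norm_triangle_ineq[of "of_real r * (cis (-\<theta>) - 1)" "complex_of_real (r - 1)"]
    by (simp only: norm_mult assms(2) mult_1)
  also have "norm (of_real r * (cis (-\<theta>) - 1)) \<le> 1 * \<bar>\<theta>\<bar>"
  proof -
    have "norm (cis (-\<theta>) - cis 0) = 2 * \<bar>sin (\<theta> / 2)\<bar>" unfolding cis_dist_sin by simp
    also have "\<dots> \<le> \<bar>\<theta>\<bar>" using abs_sin_x_le_abs_x[of "\<theta>/2"] by simp
    finally show ?thesis using r by (simp add: norm_mult mult_mono[of r 1, simplified])
  qed
  also have "norm (complex_of_real (r - 1)) = 1 - r" using r unfolding norm_of_real by simp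
  finally have "norm (z - \<eta>) \<le> (1 + A) * (1 - r)" using r by (simp add: algebra_simps)
  also have "\<dots> \<le> (1 + A) * norm (\<zeta> - z)" using 1 nz assms by (intro mult_left_mono) auto
  finally show "norm (\<zeta> - \<eta>) \<le> (2 + A) * norm (\<zeta> - z)"
    using norm_triangle_ineq[of "\<zeta> - z" "z - \<eta>"] by (simp add: algebra_simps)
qed

text \<open>The constant in the dyadic estimate of one factor of the kernel. The summand 1 makes it positive for
  all parameters, so that one may divide by it.\<close>

definition dyadic_const :: "complex \<Rightarrow> complex \<Rightarrow> real \<Rightarrow> real \<Rightarrow> real" where
  "dyadic_const a b A B = (norm (poisson_const a b) + 1) * exp (pi * (\<bar>Im a\<bar> + \<bar>Im b\<bar>)) *
     2 powr (Re a + Re b + 1) * (B powr (Re a + Re b + 1) * (2 * (2 + A)) powr (Re a + Re b + 2))"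

text \<open>The number \<open>2 powr (- s / 2)\<close> with \<open>s = Re a + Re b + 1\<close>. The decay of the kernel per dyadic
  step, relative to the volume, is the square of this number; one half of the decay goes into the level of
  the maximal function and the other half into the summation of the kernel.\<close>

definition dyadic_ratio :: "complex \<Rightarrow> complex \<Rightarrow> real" where
  "dyadic_ratio a b = 2 powr (- (Re a + Re b + 1) / 2)"

lemma dyadic_const_pos: "A \<ge> 0 \<Longrightarrow> B \<ge> 1 \<Longrightarrow> dyadic_const a b A B > 0"
  unfolding dyadic_const_def by (intro mult_pos_pos add_nonneg_pos) auto

lemma dyadic_ratio_bounds:
  assumes "Re a + Re b > -1"
  shows "0 < dyadic_ratio a b" "dyadic_ratio a b < 1"
  using assms unfolding dyadic_ratio_def by (auto intro: powr_less_one)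

text \<open>With \<open>m = \<bar>\<zeta> - z\<bar>\<close>, the assumption on \<open>k\<close> forces \<open>m\<close> to be at least a constant times \<open>2^k h\<close>: for
  \<open>k = 0\<close> since \<open>m \<ge> 1 - \<bar>z\<bar>\<close>, and for \<open>k > 0\<close> by the comparison of \<open>m\<close> with \<open>\<bar>\<zeta> - \<eta>\<bar>\<close>. The
  distance to the vertex is at least \<open>2^(k-1) h\<close>, whence the extra 2 in the constant \<open>2 (2 + A)\<close>.\<close>

lemma poisson_factor_dyadic_le:
  fixes a b :: complex
  assumes ab: "Re a + Re b > -1" and A: "A \<ge> 0" and B: "B \<ge> 1"
    and z: "z \<in> stolz A \<eta>" and \<eta>: "norm \<eta> = 1" and \<zeta>: "norm \<zeta> = 1"
    and h: "0 < h" "h \<le> 1 - norm z" "1 - norm z \<le> B * h"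
    and k: "k = 0 \<or> 2 ^ (k - 1) * h \<le> norm (\<zeta> - \<eta>)"
  shows "norm (poisson_factor a b z \<zeta>) \<le> dyadic_const a b A B * (dyadic_ratio a b ^ 2) ^ k / (2 ^ k * h)"
proof -
  define s where "s = Re a + Re b + 1"
  have s: "s > 0" using ab by (simp add: s_def)
  note st = stolz_dist_le[OF z \<eta> \<zeta> A]
  let ?L = "2 * (2 + A)"
  define m where "m = norm (\<zeta> - z)"
  have mL: "2 ^ k * h \<le> ?L * m"
  proof (cases "k = 0")
    case True
    have "h \<le> 1 * m" using h st(2) by (simp add: m_def)
    also have "\<dots> \<le> ?L * m" using A by (intro mult_right_mono) (auto simp: m_def)
    finally show ?thesis using True by simp
  next
    case False
    then have "2 ^ k * h = 2 * (2 ^ (k - 1) * h)" by (cases k) auto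
    also have "\<dots> \<le> 2 * ((2 + A) * m)" using k False st(3) by (simp add: m_def)
    finally show ?thesis by (simp only: mult.assoc)
  qed
  have Lpos: "?L > 0" using A by simp
  have ge: "2 ^ k * h / ?L \<le> m" using mL Lpos by (simp add: pos_divide_le_eq mult.commute)
  have "(1 - norm z) powr s / m powr (s + 1) \<le> (B * h) powr s / (2 ^ k * h / ?L) powr (s + 1)"
    using h s ge Lpos st(1) B by (intro frac_le powr_mono2) auto
  also have "\<dots> = B powr s * ?L powr (s + 1) * (h powr s / ((2 ^ k) powr (s + 1) * h powr (s + 1)))"
    using h B Lpos by (simp add: powr_mult powr_divide)
  also have "(h powr s / ((2 ^ k) powr (s + 1) * h powr (s + 1))) = (dyadic_ratio a b ^ 2) ^ k / (2 ^ k * h)"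
  proof -
    have 1: "h powr (s + 1) = h powr s * h" "(2 ^ k) powr (s + 1) = (2 ^ k) powr s * (2 ^ k :: real)"
      using h by (simp_all add: powr_add)
    have "dyadic_ratio a b ^ 2 = 2 powr (- s)"
      unfolding dyadic_ratio_def s_def[symmetric] power2_eq_square powr_add[symmetric] by simp
    then have "(dyadic_ratio a b ^ 2) ^ k = 1 / (2 ^ k) powr s"
      by (simp add: powr_minus_divide powr_realpow[symmetric] powr_powr power_one_over mult.commute)
    then show ?thesis unfolding 1 using h by (simp add: field_simps)
  qed
  finally have main: "(1 - norm z) powr s / m powr (s + 1) \<le>
      B powr s * ?L powr (s + 1) * ((dyadic_ratio a b ^ 2) ^ k / (2 ^ k * h))" .
  have "norm (poisson_factor a b z \<zeta>) \<le> norm (poisson_const a b) * exp (pi * (\<bar>Im a\<bar> + \<bar>Im b\<bar>)) * 2 powr s *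
      ((1 - norm z) powr s / m powr (s + 1))"
    unfolding s_def m_def using norm_poisson_factor_le[of a b z \<zeta>] st(1) \<zeta> ab by simp
  also have "\<dots> \<le> (norm (poisson_const a b) + 1) * exp (pi * (\<bar>Im a\<bar> + \<bar>Im b\<bar>)) * 2 powr s *
      (B powr s * ?L powr (s + 1) * ((dyadic_ratio a b ^ 2) ^ k / (2 ^ k * h)))"
    using main by (intro mult_mono mult_right_mono) auto
  also have "\<dots> = dyadic_const a b A B * (dyadic_ratio a b ^ 2) ^ k / (2 ^ k * h)"
    by (simp add: dyadic_const_def s_def add.assoc)
  finally show ?thesis .
qed

text \<open>The least admissible \<open>k\<close>. The upper bound \<open>N\<close> keeps the sums over \<open>k\<close> finite.\<close>

lemma dyadic_scale_exists:
  fixes t h :: real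
  assumes "t < 2 ^ N * h"
  obtains k where "k \<le> N" "t < 2 ^ k * h" "k = 0 \<or> 2 ^ (k - 1) * h \<le> t"
proof
  let ?k = "LEAST k. t < 2 ^ k * h"
  show "?k \<le> N" using assms by (rule Least_le)
  show "t < 2 ^ ?k * h" using assms by (rule LeastI)
  show "?k = 0 \<or> 2 ^ (?k - 1) * h \<le> t"
    using not_less_Least[of "?k - 1" "\<lambda>k. t < 2 ^ k * h"] by linarith
qed

section \<open>Poisson integrals of positive measures\<close>

lemma poisson_kernel_eq: "poisson_kernel \<alpha> \<beta> z \<zeta> = (\<Prod>j\<in>UNIV. poisson_factor (\<alpha> $ j) (\<beta> $ j) (z $ j) (\<zeta> $ j))"
  by (simp add: poisson_kernel_def poisson_factor_def)

text \<open>This is the only use of the restriction of the cone: the smallest of the numbers \<open>1 - \<bar>z\<^sub>j\<bar>\<close> serves as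
  a common scale for all coordinates.\<close>

lemma restricted_stolz_scale:
  fixes z :: "complex ^ 'n"
  assumes z: "z \<in> restricted_stolz A B \<eta>" and \<eta>: "\<eta> \<in> torus" and A: "A \<ge> 0"
  obtains h where "h > 0" "\<And>j. h \<le> 1 - norm (z $ j)" "\<And>j. 1 - norm (z $ j) \<le> B * h"
proof
  define H where "H j = 1 - norm (z $ j)" for j
  have pos: "H j > 0" for j
    using z \<eta> A stolz_dist_le(1)[of "z $ j" A "\<eta> $ j" 1]
    by (auto simp: restricted_stolz_def torus_def H_def)
  have "Min (range H) \<in> range H" by (rule Min_in) auto
  then obtain i where i: "Min (range H) = H i" by blast
  show "Min (range H) > 0" using pos i by simp
  show "Min (range H) \<le> 1 - norm (z $ j)" for j
    unfolding H_def[symmetric] by (rule Min_le) auto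
  show "1 - norm (z $ j) \<le> B * Min (range H)" for j
  proof -
    have "H j / H i \<le> B" using z by (simp add: restricted_stolz_def H_def)
    then show ?thesis using pos[of i] unfolding i H_def[symmetric] by (simp add: pos_divide_le_eq)
  qed
qed

text \<open>Each coordinate chooses its own dyadic scale \<open>k\<^sub>j\<close>. The bound is the reciprocal of the volume of the
  polydisc that contains \<open>\<zeta>\<close>, up to a constant and the decay \<open>\<Prod>j. (q\<^sub>j\<^sup>2)^k\<^sub>j\<close>.\<close>

lemma norm_poisson_kernel_dyadic_le:
  fixes \<alpha> \<beta> z \<zeta> \<eta> :: "complex ^ 'n"
  assumes ab: "\<And>j. Re (\<alpha> $ j) + Re (\<beta> $ j) > -1" and A: "A \<ge> 0" and B: "B \<ge> 1"
    and z: "z \<in> restricted_stolz A B \<eta>" and \<eta>: "\<eta> \<in> torus" and \<zeta>: "\<zeta> \<in> torus"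
    and h: "0 < h" "\<And>j. h \<le> 1 - norm (z $ j)" "\<And>j. 1 - norm (z $ j) \<le> B * h"
    and N: "2 < 2 ^ N * h"
  obtains k :: "'n \<Rightarrow> nat" where "\<And>j. k j \<le> N" "\<zeta> \<in> polydisc (\<lambda>j. 2 ^ k j * h) \<eta>"
    "norm (poisson_kernel \<alpha> \<beta> z \<zeta>) \<le>
      (\<Prod>j\<in>UNIV. dyadic_const (\<alpha> $ j) (\<beta> $ j) A B * (dyadic_ratio (\<alpha> $ j) (\<beta> $ j) ^ 2) ^ k j / (2 ^ k j * h))"
proof -
  have "norm (\<zeta> $ j - \<eta> $ j) < 2 ^ N * h" for j
    using norm_triangle_ineq4[of "\<zeta> $ j" "\<eta> $ j"] \<eta> \<zeta> N by (simp add: torus_def)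
  then have "\<exists>k\<le>N. norm (\<zeta> $ j - \<eta> $ j) < 2 ^ k * h \<and> (k = 0 \<or> 2 ^ (k - 1) * h \<le> norm (\<zeta> $ j - \<eta> $ j))" for j
    using dyadic_scale_exists by metis
  then obtain k where k: "\<And>j. k j \<le> N" "\<And>j. norm (\<zeta> $ j - \<eta> $ j) < 2 ^ k j * h"
    "\<And>j. k j = 0 \<or> 2 ^ (k j - 1) * h \<le> norm (\<zeta> $ j - \<eta> $ j)" by metis
  show ?thesis
  proof (rule that)
    show "norm (poisson_kernel \<alpha> \<beta> z \<zeta>) \<le>
      (\<Prod>j\<in>UNIV. dyadic_const (\<alpha> $ j) (\<beta> $ j) A B * (dyadic_ratio (\<alpha> $ j) (\<beta> $ j) ^ 2) ^ k j / (2 ^ k j * h))"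
      unfolding poisson_kernel_eq prod_norm[symmetric]
    proof (rule prod_mono, intro conjI)
      fix j
      show "norm (poisson_factor (\<alpha> $ j) (\<beta> $ j) (z $ j) (\<zeta> $ j)) \<le>
        dyadic_const (\<alpha> $ j) (\<beta> $ j) A B * (dyadic_ratio (\<alpha> $ j) (\<beta> $ j) ^ 2) ^ k j / (2 ^ k j * h)"
        using z \<eta> \<zeta>
        by (intro poisson_factor_dyadic_le[where \<eta> = "\<eta> $ j"] ab A B h k)
           (auto simp: restricted_stolz_def torus_def)
    qed simp
  qed (use k in \<open>auto simp: polydisc_def\<close>)
qed

lemma sum_prod_geometric_le:
  fixes q :: "'n::finite \<Rightarrow> real"
  assumes q: "\<And>j. 0 < q j" "\<And>j. q j < 1"
  shows "(\<Sum>k\<in>UNIV \<rightarrow>\<^sub>E {..N}. \<Prod>j\<in>UNIV. q j ^ k j) \<le> (\<Prod>j\<in>UNIV. 1 / (1 - q j))"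
proof -
  have "(\<Sum>k\<in>UNIV \<rightarrow>\<^sub>E {..N}. \<Prod>j\<in>UNIV. q j ^ k j) = (\<Prod>j\<in>UNIV. \<Sum>i\<le>N. q j ^ i)"
    by (subst prod_sum_PiE) auto
  also have "\<dots> \<le> (\<Prod>j\<in>UNIV. 1 / (1 - q j))"
  proof (rule prod_mono, intro conjI)
    fix j
    show "0 \<le> (\<Sum>i\<le>N. q j ^ i)" using q(1)[of j] by (intro sum_nonneg) simp
    have "(1 - q j) * (\<Sum>i\<le>N. q j ^ i) = 1 - q j ^ Suc N"
      using q(2)[of j] sum_gp0[of "q j" N] by simp
    also have "\<dots> \<le> 1" using q(1)[of j] by simp
    finally show "(\<Sum>i\<le>N. q j ^ i) \<le> 1 / (1 - q j)"
      using q(2)[of j] by (simp add: pos_le_divide_eq mult.commute)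
  qed
  finally show ?thesis .
qed

text \<open>The piece of the kernel with index \<open>k\<close> carries the weight \<open>\<Prod>j. (q\<^sub>j\<^sup>2)^k\<^sub>j\<close> and meets an average of
  \<open>\<nu>\<close> of size \<open>L \<Prod>j. (1/q\<^sub>j)^k\<^sub>j\<close>; the product \<open>L \<Prod>j. q\<^sub>j^k\<^sub>j\<close> is summable over \<open>k\<close>.\<close>

lemma poisson_kernel_integral_le:
  fixes \<alpha> \<beta> z \<eta> :: "complex ^ 'n" and \<nu> :: "(complex ^ 'n) measure"
  defines "q \<equiv> \<lambda>j. dyadic_ratio (\<alpha> $ j) (\<beta> $ j)"
  assumes ab: "\<And>j. Re (\<alpha> $ j) + Re (\<beta> $ j) > -1" and A: "A \<ge> 0" and B: "B \<ge> 1"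
    and sets: "sets \<nu> = sets torus_borel" and L: "L > 0"
    and z: "z \<in> restricted_stolz A B \<eta>" and \<eta>: "\<eta> \<in> torus"
    and avg: "\<And>(k :: 'n \<Rightarrow> nat) h. h > 0 \<Longrightarrow>
      emeasure \<nu> (torus \<inter> polydisc (\<lambda>j. 2 ^ k j * h) \<eta>) \<le> ennreal (L * (\<Prod>j\<in>UNIV. (1 / q j) ^ k j) * (\<Prod>j\<in>UNIV. 2 ^ k j * h))"
  shows "(\<integral>\<^sup>+\<zeta>. ennreal (norm (poisson_kernel \<alpha> \<beta> z \<zeta>)) \<partial>\<nu>) \<le>
    ennreal (L * (\<Prod>j\<in>UNIV. dyadic_const (\<alpha> $ j) (\<beta> $ j) A B) * (\<Prod>j\<in>UNIV. 1 / (1 - q j)))"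
proof -
  define C where "C j = dyadic_const (\<alpha> $ j) (\<beta> $ j) A B" for j
  have q: "0 < q j" "q j < 1" for j unfolding q_def by (rule dyadic_ratio_bounds[OF ab])+
  have C: "0 < C j" for j unfolding C_def by (rule dyadic_const_pos[OF A B])
  obtain h where h: "h > 0" "\<And>j. h \<le> 1 - norm (z $ j)" "\<And>j. 1 - norm (z $ j) \<le> B * h"
    using restricted_stolz_scale[OF z \<eta> A] by blast
  \<comment> \<open>At scale \<open>N\<close> the polydisc contains the torus, which has diameter 2 in each coordinate.\<close>
  obtain N where "2 / h < 2 ^ N" using real_arch_pow[of 2 "2/h"] by auto
  then have N: "2 < 2 ^ N * h" using h(1) by (simp add: pos_divide_less_eq)
  define K where "K = (UNIV :: 'n set) \<rightarrow>\<^sub>E {..N}"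
  have K: "finite K" unfolding K_def by (intro finite_PiE) auto
  define w where "w k = (\<Prod>j\<in>UNIV. C j * (q j ^ 2) ^ k j / (2 ^ k j * h))" for k :: "'n \<Rightarrow> nat"
  define R where "R k = torus \<inter> polydisc (\<lambda>j. 2 ^ k j * h) \<eta>" for k :: "'n \<Rightarrow> nat"
  have R: "R k \<in> sets \<nu>" for k unfolding R_def sets by (rule torus_Int_open[OF open_polydisc])
  have w: "w k \<ge> 0" for k unfolding w_def using C h(1) by (intro prod_nonneg) (auto intro!: mult_nonneg_nonneg divide_nonneg_nonneg simp: less_imp_le)
  have "(\<integral>\<^sup>+\<zeta>. ennreal (norm (poisson_kernel \<alpha> \<beta> z \<zeta>)) \<partial>\<nu>) \<le> (\<integral>\<^sup>+\<zeta>. (\<Sum>k\<in>K. ennreal (w k) * indicator (R k) \<zeta>) \<partial>\<nu>)"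
  proof (rule nn_integral_mono)
    fix \<zeta> assume "\<zeta> \<in> space \<nu>"
    then have \<zeta>: "\<zeta> \<in> torus" using sets_eq_imp_space_eq[OF sets] by simp
    obtain k :: "'n \<Rightarrow> nat" where k: "\<And>j. k j \<le> N" "\<zeta> \<in> polydisc (\<lambda>j. 2 ^ k j * h) \<eta>"
      "norm (poisson_kernel \<alpha> \<beta> z \<zeta>) \<le> w k"
      unfolding w_def C_def q_def
      by (rule norm_poisson_kernel_dyadic_le[OF ab A B z \<eta> \<zeta> h N]) blast
    have "ennreal (norm (poisson_kernel \<alpha> \<beta> z \<zeta>)) \<le> ennreal (w k) * indicator (R k) \<zeta>"
      using k \<zeta> by (simp add: R_def ennreal_leI)
    also have "\<dots> \<le> (\<Sum>k\<in>K. ennreal (w k) * indicator (R k) \<zeta>)"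
      using K k(1) by (intro member_le_sum) (auto simp: K_def)
    finally show "ennreal (norm (poisson_kernel \<alpha> \<beta> z \<zeta>)) \<le> (\<Sum>k\<in>K. ennreal (w k) * indicator (R k) \<zeta>)" .
  qed
  also have "\<dots> = (\<Sum>k\<in>K. ennreal (w k) * emeasure \<nu> (R k))"
    using R by (simp add: nn_integral_sum nn_integral_cmult_indicator)
  also have "\<dots> \<le> (\<Sum>k\<in>K. ennreal (L * (\<Prod>j\<in>UNIV. C j) * (\<Prod>j\<in>UNIV. q j ^ k j)))"
  proof (rule sum_mono)
    fix k
    have "ennreal (w k) * emeasure \<nu> (R k) \<le>
        ennreal (w k) * ennreal (L * (\<Prod>j\<in>UNIV. (1 / q j) ^ k j) * (\<Prod>j\<in>UNIV. 2 ^ k j * h))"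
      unfolding R_def by (intro mult_left_mono avg h) auto
    also have "\<dots> = ennreal (w k * (L * (\<Prod>j\<in>UNIV. (1 / q j) ^ k j) * (\<Prod>j\<in>UNIV. 2 ^ k j * h)))"
      using w by (simp add: ennreal_mult')
    also have "w k * (L * (\<Prod>j\<in>UNIV. (1 / q j) ^ k j) * (\<Prod>j\<in>UNIV. 2 ^ k j * h)) =
        L * (w k * (\<Prod>j\<in>UNIV. (1 / q j) ^ k j) * (\<Prod>j\<in>UNIV. 2 ^ k j * h))" by simp
    also have "w k * (\<Prod>j\<in>UNIV. (1 / q j) ^ k j) * (\<Prod>j\<in>UNIV. 2 ^ k j * h) = (\<Prod>j\<in>UNIV. C j * q j ^ k j)"
      unfolding w_def prod.distrib[symmetric]
    proof (rule prod.cong)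
      fix j
      have "(q j ^ 2) ^ k j = q j ^ k j * q j ^ k j" by (simp add: power2_eq_square power_mult_distrib)
      then show "C j * (q j ^ 2) ^ k j / (2 ^ k j * h) * (1 / q j) ^ k j * (2 ^ k j * h) = C j * q j ^ k j"
        using q(1)[of j] h(1) by (simp add: power_one_over)
    qed simp
    also have "L * (\<Prod>j\<in>UNIV. C j * q j ^ k j) = L * (\<Prod>j\<in>UNIV. C j) * (\<Prod>j\<in>UNIV. q j ^ k j)"
      by (simp add: prod.distrib)
    finally show "ennreal (w k) * emeasure \<nu> (R k) \<le> ennreal (L * (\<Prod>j\<in>UNIV. C j) * (\<Prod>j\<in>UNIV. q j ^ k j))" .
  qed
  also have "\<dots> = ennreal (L * (\<Prod>j\<in>UNIV. C j) * (\<Sum>k\<in>K. \<Prod>j\<in>UNIV. q j ^ k j))"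
  proof -
    have "0 \<le> L * (\<Prod>j\<in>UNIV. C j) * (\<Prod>j\<in>UNIV. q j ^ k j)" for k :: "'n \<Rightarrow> nat"
      using L C q by (intro mult_nonneg_nonneg prod_nonneg) (auto simp: less_imp_le)
    then show ?thesis by (simp only: sum_ennreal sum_distrib_left)
  qed
  also have "\<dots> \<le> ennreal (L * (\<Prod>j\<in>UNIV. C j) * (\<Prod>j\<in>UNIV. 1 / (1 - q j)))"
    unfolding K_def using L C sum_prod_geometric_le[of q N] q
    by (intro ennreal_leI mult_left_mono mult_nonneg_nonneg prod_nonneg) (auto simp: less_imp_le)
  finally show ?thesis by (simp only: C_def)
qed

text \<open>Off the union over \<open>k\<close> of the exceptional sets of the polydisc averages at the levels \<open>T k\<close>, the
  preceding lemma bounds the Poisson integrals; the factor \<open>1 / G\<close> in the level makes this bound equal to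
  \<open>lam\<close>. The measures of the exceptional sets are proportional to \<open>1 / T k\<close> and sum to a geometric
  series.\<close>

lemma weak_type_positive_measure:
  fixes \<alpha> \<beta> :: "complex ^ 'n"
  assumes ab: "\<And>j. Re (\<alpha> $ j) + Re (\<beta> $ j) > -1" and A: "A \<ge> 0" and B: "B \<ge> 1"
  obtains C where "C > 0"
    and "\<And>(\<nu> :: (complex ^ 'n) measure) lam. sets \<nu> = sets torus_borel \<Longrightarrow> lam > 0 \<Longrightarrow>
      \<exists>U\<in>sets torus_haar.
        {\<eta> \<in> torus. \<exists>z\<in>restricted_stolz A B \<eta>. ennreal lam < (\<integral>\<^sup>+\<zeta>. ennreal (norm (poisson_kernel \<alpha> \<beta> z \<zeta>)) \<partial>\<nu>)} \<subseteq> U \<and>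
        emeasure torus_haar U \<le> ennreal (C / lam) * emeasure \<nu> torus"
proof -
  define q where "q j = dyadic_ratio (\<alpha> $ j) (\<beta> $ j)" for j
  have q: "0 < q j" "q j < 1" for j unfolding q_def by (rule dyadic_ratio_bounds[OF ab])+
  define S where "S = (\<Prod>j\<in>UNIV. 1 / (1 - q j))"
  define G where "G = (\<Prod>j\<in>UNIV. dyadic_const (\<alpha> $ j) (\<beta> $ j) A B) * S"
  have S: "S > 0" unfolding S_def using q by (intro prod_pos) auto
  have G: "G > 0" unfolding G_def using S dyadic_const_pos[OF A B] by (intro mult_pos_pos prod_pos) auto
  let ?K = "(18/pi) ^ CARD('n)"
  show ?thesis
  proof (rule that[of "?K * G * S"])
    show "?K * G * S > 0" using G S by simp
    fix \<nu> :: "(complex ^ 'n) measure" and lam :: real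
    assume sets: "sets \<nu> = sets torus_borel" and lam: "lam > 0"
    define T where "T k = lam / G * (\<Prod>j\<in>UNIV. (1 / q j) ^ k j)" for k :: "'n \<Rightarrow> nat"
    have T: "T k > 0" for k unfolding T_def using lam G q by (intro mult_pos_pos prod_pos) auto
    define E where "E k = {\<eta> \<in> torus. \<exists>h>0. ennreal (T k * (\<Prod>j\<in>UNIV. 2 ^ k j * h)) <
       emeasure \<nu> (torus \<inter> polydisc (\<lambda>j. 2 ^ k j * h) \<eta>)}" for k :: "'n \<Rightarrow> nat"
    have "\<exists>U\<in>sets torus_haar. E k \<subseteq> U \<and> emeasure torus_haar U \<le> ennreal (?K / T k) * emeasure \<nu> torus" for k
      unfolding E_def by (rule weak_type_polydisc_maximal[OF sets _ T]) simp
    then obtain U where U: "\<And>k. U k \<in> sets torus_haar" "\<And>k. E k \<subseteq> U k"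
      "\<And>k. emeasure torus_haar (U k) \<le> ennreal (?K / T k) * emeasure \<nu> torus" by metis
    \<comment> \<open>Exhaustion of the multi-indices by finite cubes reduces countable to finite subadditivity.\<close>
    define K where "K N = (UNIV :: 'n set) \<rightarrow>\<^sub>E {..N}" for N :: nat
    have K: "finite (K N)" for N unfolding K_def by (intro finite_PiE) auto
    define V where "V N = (\<Union>k\<in>K N. U k)" for N
    have V: "V N \<in> sets torus_haar" for N unfolding V_def using K U(1) by (intro sets.finite_UN)
    have Vb: "emeasure torus_haar (V N) \<le> ennreal (?K * G * S / lam) * emeasure \<nu> torus" for N
    proof -
      have "emeasure torus_haar (V N) \<le> (\<Sum>k\<in>K N. emeasure torus_haar (U k))"
        unfolding V_def using K U(1) by (intro emeasure_subadditive_finite) auto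
      also have "\<dots> \<le> (\<Sum>k\<in>K N. ennreal (?K / T k) * emeasure \<nu> torus)" by (intro sum_mono U)
      also have "\<dots> = ennreal (\<Sum>k\<in>K N. ?K / T k) * emeasure \<nu> torus"
        using T by (simp add: sum_distrib_right[symmetric] sum_ennreal less_imp_le)
      also have "(\<Sum>k\<in>K N. ?K / T k) = ?K * G / lam * (\<Sum>k\<in>K N. \<Prod>j\<in>UNIV. q j ^ k j)"
        unfolding sum_distrib_left T_def
        by (intro sum.cong refl) (simp add: power_one_over prod_dividef)
      also have "ennreal \<dots> * emeasure \<nu> torus \<le> ennreal (?K * G / lam * S) * emeasure \<nu> torus"
        unfolding S_def K_def using sum_prod_geometric_le[of q N] q G lam
        by (intro mult_right_mono ennreal_leI mult_left_mono) auto
      finally show ?thesis by simp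
    qed
    show "\<exists>U\<in>sets torus_haar.
      {\<eta> \<in> torus. \<exists>z\<in>restricted_stolz A B \<eta>. ennreal lam < (\<integral>\<^sup>+\<zeta>. ennreal (norm (poisson_kernel \<alpha> \<beta> z \<zeta>)) \<partial>\<nu>)} \<subseteq> U \<and>
      emeasure torus_haar U \<le> ennreal (?K * G * S / lam) * emeasure \<nu> torus"
    proof (intro bexI[of _ "\<Union>N. V N"] conjI subsetI)
      show "(\<Union>N. V N) \<in> sets torus_haar" using V by blast
      have "incseq V" unfolding V_def K_def
        by (intro incseq_SucI UN_mono PiE_mono) auto
      then have "emeasure torus_haar (\<Union>N. V N) = (SUP N. emeasure torus_haar (V N))"
        using V by (intro SUP_emeasure_incseq[symmetric]) auto
      also have "\<dots> \<le> ennreal (?K * G * S / lam) * emeasure \<nu> torus" by (intro SUP_least Vb)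
      finally show "emeasure torus_haar (\<Union>N. V N) \<le> ennreal (?K * G * S / lam) * emeasure \<nu> torus" .
      fix \<eta> assume "\<eta> \<in> {\<eta> \<in> torus. \<exists>z\<in>restricted_stolz A B \<eta>. ennreal lam < (\<integral>\<^sup>+\<zeta>. ennreal (norm (poisson_kernel \<alpha> \<beta> z \<zeta>)) \<partial>\<nu>)}"
      then obtain z where \<eta>: "\<eta> \<in> torus" and z: "z \<in> restricted_stolz A B \<eta>"
        "ennreal lam < (\<integral>\<^sup>+\<zeta>. ennreal (norm (poisson_kernel \<alpha> \<beta> z \<zeta>)) \<partial>\<nu>)" by blast
      have "\<exists>k. \<eta> \<in> E k"
      proof (rule ccontr)
        assume no: "\<not> (\<exists>k. \<eta> \<in> E k)"
        have "(\<integral>\<^sup>+\<zeta>. ennreal (norm (poisson_kernel \<alpha> \<beta> z \<zeta>)) \<partial>\<nu>) \<le>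
          ennreal (lam / G * (\<Prod>j\<in>UNIV. dyadic_const (\<alpha> $ j) (\<beta> $ j) A B) *
             (\<Prod>j\<in>UNIV. 1 / (1 - dyadic_ratio (\<alpha> $ j) (\<beta> $ j))))"
        proof (rule poisson_kernel_integral_le[OF ab A B sets _ z(1) \<eta>])
          show "lam / G > 0" using lam G by simp
          fix k :: "'n \<Rightarrow> nat" and h :: real assume "h > 0"
          then have "\<not> ennreal (T k * (\<Prod>j\<in>UNIV. 2 ^ k j * h)) < emeasure \<nu> (torus \<inter> polydisc (\<lambda>j. 2 ^ k j * h) \<eta>)"
            using no \<eta> unfolding E_def by blast
          then show "emeasure \<nu> (torus \<inter> polydisc (\<lambda>j. 2 ^ k j * h) \<eta>) \<le>
            ennreal (lam / G * (\<Prod>j\<in>UNIV. (1 / dyadic_ratio (\<alpha> $ j) (\<beta> $ j)) ^ k j) * (\<Prod>j\<in>UNIV. 2 ^ k j * h))"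
            unfolding T_def q_def by (simp only: not_less)
        qed
        also have "lam / G * (\<Prod>j\<in>UNIV. dyadic_const (\<alpha> $ j) (\<beta> $ j) A B) *
             (\<Prod>j\<in>UNIV. 1 / (1 - dyadic_ratio (\<alpha> $ j) (\<beta> $ j))) = lam / G * G"
          unfolding G_def S_def q_def by (simp only: mult.assoc)
        also have "\<dots> = lam" using G by simp
        finally show False using z(2) by simp
      qed
      then obtain k where k: "\<eta> \<in> E k" ..
      have "k \<in> K (Max (range k))" unfolding K_def by auto
      then show "\<eta> \<in> (\<Union>N. V N)" using k U(2) unfolding V_def by blast
    qed
  qed
qed

section \<open>Measurability of the superlevel sets\<close>

lemma continuous_on_powr_const_right_half_plane:
  fixes f :: "'a::topological_space \<Rightarrow> complex"
  assumes "continuous_on S f" "\<And>x. x \<in> S \<Longrightarrow> Re (f x) > 0"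
  shows "continuous_on S (\<lambda>x. f x powr c)"
proof (rule continuous_on_powr_complex)
  show "S \<subseteq> {x. Re (f x) \<ge> 0 \<or> Im (f x) \<noteq> 0}" using assms(2) by (force intro: less_imp_le)
  show "Re c > 0" if "x \<in> S" "f x = 0" for x using assms(2)[OF that(1)] that(2) by simp
qed (use assms in auto)

lemma Re_one_minus_pos: "norm w < 1 \<Longrightarrow> Re (1 - w) > 0"
  using complex_Re_le_cmod[of w] by simp

lemma continuous_on_poisson_factor:
  fixes f g :: "'a::topological_space \<Rightarrow> complex"
  assumes f: "continuous_on S f" and g: "continuous_on S g"
    and fg: "\<And>x. x \<in> S \<Longrightarrow> norm (f x) < 1" "\<And>x. x \<in> S \<Longrightarrow> norm (g x) = 1"
  shows "continuous_on S (\<lambda>x. poisson_factor a b (f x) (g x))"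
proof -
  have pos: "Re (1 - f x * cnj (g x)) > 0" "Re (1 - cnj (f x) * g x) > 0" if "x \<in> S" for x
    using fg[OF that] by (auto intro!: Re_one_minus_pos simp: norm_mult simp del: minus_complex.sel)
  have nz: "1 - f x * cnj (g x) \<noteq> 0" "1 - cnj (f x) * g x \<noteq> 0" if "x \<in> S" for x
    using pos[OF that] by (metis less_irrefl zero_complex.sel(1))+
  have num: "Re (complex_of_real (1 - (norm (f x))\<^sup>2)) > 0" if "x \<in> S" for x
    using fg(1)[OF that] by (simp add: abs_square_less_1)
  show ?thesis
    unfolding poisson_factor_def
    by (intro continuous_on_mult continuous_on_const continuous_on_divide
        continuous_on_powr_const_right_half_plane pos num ballI)
       (use nz f g in \<open>auto intro!: continuous_intros\<close>)
qed

text \<open>The bound depends only on the modulus of \<open>z\<close>; hence it is a common majorant for all rotations of a given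
  point.\<close>

lemma norm_poisson_factor_le_radius:
  assumes "Re a + Re b > -1" and z: "norm z < 1" and \<zeta>: "norm \<zeta> = 1"
  shows "norm (poisson_factor a b z \<zeta>) \<le>
    norm (poisson_const a b) * exp (pi * (\<bar>Im a\<bar> + \<bar>Im b\<bar>)) * 2 powr (Re a + Re b + 1) * (1 / (1 - norm z))"
proof -
  let ?s = "Re a + Re b + 1"
  have "1 - norm z \<le> norm (\<zeta> - z)" using norm_triangle_ineq2[of \<zeta> z] \<zeta> by simp
  then have "(1 - norm z) powr ?s / norm (\<zeta> - z) powr (?s + 1) \<le> (1 - norm z) powr ?s / (1 - norm z) powr (?s + 1)"
    using assms by (intro divide_left_mono powr_mono2 mult_pos_pos) auto
  also have "\<dots> = 1 / (1 - norm z)" using z by (simp add: powr_add power2_eq_square)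
  finally have le: "(1 - norm z) powr ?s / norm (\<zeta> - z) powr (?s + 1) \<le> 1 / (1 - norm z)" .
  have "norm (poisson_factor a b z \<zeta>) \<le>
    norm (poisson_const a b) * exp (pi * (\<bar>Im a\<bar> + \<bar>Im b\<bar>)) * 2 powr ?s *
      ((1 - norm z) powr ?s / norm (\<zeta> - z) powr (?s + 1))"
    by (rule norm_poisson_factor_le) (use assms in auto)
  also have "\<dots> \<le> norm (poisson_const a b) * exp (pi * (\<bar>Im a\<bar> + \<bar>Im b\<bar>)) * 2 powr ?s * (1 / (1 - norm z))"
    by (intro mult_left_mono le) auto
  finally show ?thesis .
qed

text \<open>Dominated convergence: the kernel is continuous in \<open>\<eta>\<close> and bounded uniformly in \<open>\<eta>\<close> and \<open>\<zeta>\<close>.\<close>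

lemma continuous_on_kernel_integral:
  fixes \<alpha> \<beta> w :: "complex ^ 'n" and \<nu> :: "(complex ^ 'n) measure"
  assumes ab: "\<And>j. Re (\<alpha> $ j) + Re (\<beta> $ j) > -1" and w: "\<And>j. norm (w $ j) < 1"
    and \<nu>: "finite_measure \<nu>" "sets \<nu> = sets torus_borel"
  shows "continuous_on torus (\<lambda>\<eta>. LINT \<zeta>|\<nu>. poisson_kernel \<alpha> \<beta> (\<chi> j. \<eta> $ j * w $ j) \<zeta>)"
  unfolding continuous_on_sequentially
proof (intro allI ballI impI, elim conjE)
  interpret finite_measure \<nu> by fact
  let ?f = "\<lambda>\<eta> \<zeta>. poisson_kernel \<alpha> \<beta> (\<chi> j. \<eta> $ j * w $ j) \<zeta>"
  fix x :: "nat \<Rightarrow> complex ^ 'n" and \<eta>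
  assume \<eta>: "\<eta> \<in> torus" and x: "\<forall>n. x n \<in> torus" and lim: "x \<longlonglongrightarrow> \<eta>"
  have r: "norm (\<xi> $ j * w $ j) = norm (w $ j)" if "\<xi> \<in> torus" for \<xi> :: "complex ^ 'n" and j
    using that by (simp add: torus_def norm_mult)
  have meas: "?f \<xi> \<in> borel_measurable \<nu>" if \<xi>: "\<xi> \<in> torus" for \<xi>
  proof -
    have "continuous_on torus (?f \<xi>)"
      unfolding poisson_kernel_eq
      by (intro continuous_on_prod continuous_on_poisson_factor continuous_intros)
         (use w r[OF \<xi>] in \<open>auto simp: torus_def\<close>)
    then have "?f \<xi> \<in> borel_measurable torus_borel"
      unfolding torus_borel_def by (rule borel_measurable_continuous_on_restrict)
    then show ?thesis using measurable_cong_sets[OF \<nu>(2) refl] by blast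
  qed
  define K where "K = (\<Prod>j\<in>UNIV. norm (poisson_const (\<alpha> $ j) (\<beta> $ j)) * exp (pi * (\<bar>Im (\<alpha> $ j)\<bar> + \<bar>Im (\<beta> $ j)\<bar>)) *
     2 powr (Re (\<alpha> $ j) + Re (\<beta> $ j) + 1) * (1 / (1 - norm (w $ j))))"
  have space: "space \<nu> = torus" using sets_eq_imp_space_eq[OF \<nu>(2)] by simp
  have bound: "norm (?f \<xi> \<zeta>) \<le> K" if \<xi>: "\<xi> \<in> torus" and \<zeta>: "\<zeta> \<in> torus" for \<xi> \<zeta>
    unfolding poisson_kernel_eq prod_norm[symmetric] K_def
  proof (rule prod_mono, intro conjI)
    fix j
    have "norm (\<zeta> $ j) = 1" using \<zeta> by (simp add: torus_def)
    then show "norm (poisson_factor (\<alpha> $ j) (\<beta> $ j) ((\<chi> j. \<xi> $ j * w $ j) $ j) (\<zeta> $ j)) \<le>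
      norm (poisson_const (\<alpha> $ j) (\<beta> $ j)) * exp (pi * (\<bar>Im (\<alpha> $ j)\<bar> + \<bar>Im (\<beta> $ j)\<bar>)) *
     2 powr (Re (\<alpha> $ j) + Re (\<beta> $ j) + 1) * (1 / (1 - norm (w $ j)))"
      using norm_poisson_factor_le_radius[OF ab, of "\<xi> $ j * w $ j" "\<zeta> $ j" j] r[OF \<xi>, of j] w[of j]
      by (simp only: vec_lambda_beta)
  qed simp
  have conv: "(\<lambda>n. ?f (x n) \<zeta>) \<longlonglongrightarrow> ?f \<eta> \<zeta>" if \<zeta>: "\<zeta> \<in> torus" for \<zeta>
  proof -
    have "continuous_on torus (\<lambda>\<eta>. ?f \<eta> \<zeta>)"
      unfolding poisson_kernel_eq
      by (intro continuous_on_prod continuous_on_poisson_factor continuous_intros)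
         (use w r \<zeta> in \<open>auto simp: torus_def\<close>)
    then show ?thesis
      using \<eta> x lim unfolding continuous_on_sequentially comp_def by blast
  qed
  show "((\<lambda>\<eta>. LINT \<zeta>|\<nu>. ?f \<eta> \<zeta>) \<circ> x) \<longlonglongrightarrow> (LINT \<zeta>|\<nu>. ?f \<eta> \<zeta>)"
    unfolding comp_def
  proof (rule integral_dominated_convergence)
    show "integrable \<nu> (\<lambda>_. K)" by simp
  qed (use meas \<eta> x bound conv space in auto)
qed

lemma stolz_rotate:
  assumes "z \<in> stolz A \<eta>"
  shows "u * z \<in> stolz A (u * \<eta>)"
  using assms by (auto simp: stolz_def mult_ac)

lemma restricted_stolz_rotate:
  assumes "u \<in> torus" and "z \<in> restricted_stolz A B \<eta>"
  shows "(\<chi> j. u $ j * z $ j) \<in> restricted_stolz A B (\<chi> j. u $ j * \<eta> $ j)"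
  using assms by (auto simp: restricted_stolz_def torus_def norm_mult intro: stolz_rotate)

lemma restricted_stolz_eq_rotation:
  fixes \<eta> :: "complex ^ 'n"
  assumes \<eta>: "\<eta> \<in> torus"
  shows "restricted_stolz A B \<eta> = (\<lambda>w. \<chi> j. \<eta> $ j * w $ j) ` restricted_stolz A B (\<chi> j. 1)"
proof (intro subset_antisym subsetI)
  have unit: "\<eta> $ j * cnj (\<eta> $ j) = 1" for j
    using \<eta> complex_norm_square[of "\<eta> $ j"] by (simp add: torus_def)
  fix z assume z: "z \<in> restricted_stolz A B \<eta>"
  let ?w = "\<chi> j. (\<chi> j. cnj (\<eta> $ j)) $ j * z $ j"
  have "?w \<in> restricted_stolz A B (\<chi> j. (\<chi> j. cnj (\<eta> $ j)) $ j * \<eta> $ j)"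
    using \<eta> by (intro restricted_stolz_rotate z) (simp add: torus_def)
  also have "(\<chi> j. (\<chi> j. cnj (\<eta> $ j)) $ j * \<eta> $ j) = (\<chi> j. 1)"
    using unit by (simp add: vec_eq_iff mult.commute)
  finally have "?w \<in> restricted_stolz A B (\<chi> j. 1)" .
  moreover have "z = (\<chi> j. \<eta> $ j * ?w $ j)"
    using unit by (simp add: vec_eq_iff mult.assoc[symmetric])
  ultimately show "z \<in> (\<lambda>w. \<chi> j. \<eta> $ j * w $ j) ` restricted_stolz A B (\<chi> j. 1)" by blast
next
  fix z assume "z \<in> (\<lambda>w. \<chi> j. \<eta> $ j * w $ j) ` restricted_stolz A B (\<chi> j. 1)"
  then show "z \<in> restricted_stolz A B \<eta>"
    using restricted_stolz_rotate[OF \<eta>, of _ A B "\<chi> j. 1"] by auto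
qed

lemma Re_Im_parts_le_norm:
  "Re w \<le> norm w" "- Re w \<le> norm w" "Im w \<le> norm w" "- Im w \<le> norm w"
  using abs_Re_le_cmod[of w] abs_Im_le_cmod[of w] by linarith+

text \<open>The supremum runs over an uncountable set, but the rotation makes this set independent of \<open>\<eta>\<close>, and a
  supremum of continuous functions of \<open>\<eta>\<close> has relatively open superlevel sets.\<close>

lemma nt_maximal_superlevel_measurable:
  fixes \<alpha> \<beta> :: "complex ^ 'n"
  assumes ab: "\<And>j. Re (\<alpha> $ j) + Re (\<beta> $ j) > -1" and A: "A \<ge> 0"
    and \<mu>: "complex_measure torus_borel \<mu>" and lam: "lam \<ge> 0"
  shows "{\<eta> \<in> torus. nt_maximal \<alpha> \<beta> A B \<mu> \<eta> > ennreal lam} \<in> sets torus_borel"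
proof -
  let ?F = "\<lambda>w \<eta>. poisson_integral \<alpha> \<beta> \<mu> (\<chi> j. \<eta> $ j * w $ j)"
  let ?R = "restricted_stolz A B (\<chi> j. 1) :: (complex ^ 'n) set"
  have cont: "continuous_on torus (?F w)" if w: "w \<in> ?R" for w
  proof -
    have "norm (w $ j) < 1" for j
      using w A by (intro stolz_dist_le(1)[where \<eta> = 1 and \<zeta> = 1]) (auto simp: restricted_stolz_def)
    note c = continuous_on_kernel_integral[OF ab this]
    show ?thesis
      unfolding poisson_integral_def complex_measure_integral_def
      by (intro continuous_on_add continuous_on_diff continuous_on_mult continuous_on_const c
          pos_part_measure_mass(1)[OF \<mu>] sets_pos_part_measure Re_Im_parts_le_norm)
  qed
  have "{\<eta> \<in> torus. nt_maximal \<alpha> \<beta> A B \<mu> \<eta> > ennreal lam} =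
      (\<Union>w\<in>?R. torus \<inter> (\<lambda>\<eta>. norm (?F w \<eta>)) -` {lam<..})"
    using lam by (auto simp: nt_maximal_def restricted_stolz_eq_rotation less_SUP_iff ennreal_less_iff)
  moreover have "openin (top_of_set torus) (\<Union>w\<in>?R. torus \<inter> (\<lambda>\<eta>. norm (?F w \<eta>)) -` {lam<..})"
    using cont by (intro openin_Union) (auto intro!: continuous_openin_preimage_gen continuous_on_norm)
  ultimately obtain O' where "open O'" "{\<eta> \<in> torus. nt_maximal \<alpha> \<beta> A B \<mu> \<eta> > ennreal lam} = torus \<inter> O'"
    by (auto simp: openin_open)
  then show ?thesis using torus_Int_open by metis
qed

section \<open>The restricted non-tangential maximal function\<close>

theorem theorem4p6:
  fixes \<alpha> \<beta> :: "complex ^ 'n" and A B :: real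
  assumes "\<And>j. Re (\<alpha> $ j) + Re (\<beta> $ j) > -1"
    and "\<And>j (k::nat). k \<ge> 1 \<Longrightarrow> \<alpha> $ j \<noteq> - of_nat k"
    and "\<And>j (k::nat). k \<ge> 1 \<Longrightarrow> \<beta> $ j \<noteq> - of_nat k"
    and "0 < A" and "1 \<le> B"
  shows "\<exists>C::real. C \<ge> 0 \<and>
    (\<forall>\<mu> :: (complex ^ 'n) set \<Rightarrow> complex. complex_measure torus_borel \<mu> \<longrightarrow>
      (\<forall>lam::real. lam > 0 \<longrightarrow>
        {\<eta> \<in> torus. nt_maximal \<alpha> \<beta> A B \<mu> \<eta> > ennreal lam} \<in> sets torus_haar \<and>
        emeasure torus_haar {\<eta> \<in> torus. nt_maximal \<alpha> \<beta> A B \<mu> \<eta> > ennreal lam}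
          \<le> ennreal C * total_variation torus_borel \<mu> / ennreal lam))"
proof -
  have A: "A \<ge> 0" using assms(4) by simp
  obtain C where C: "C > 0" and weak: "\<And>(\<nu> :: (complex ^ 'n) measure) lam. sets \<nu> = sets torus_borel \<Longrightarrow> lam > 0 \<Longrightarrow>
    \<exists>U\<in>sets torus_haar.
      {\<eta> \<in> torus. \<exists>z\<in>restricted_stolz A B \<eta>. ennreal lam < (\<integral>\<^sup>+\<zeta>. ennreal (norm (poisson_kernel \<alpha> \<beta> z \<zeta>)) \<partial>\<nu>)} \<subseteq> U \<and>
      emeasure torus_haar U \<le> ennreal (C / lam) * emeasure \<nu> torus"
    by (rule weak_type_positive_measure[OF assms(1) A assms(5)]) (rule that; blast)
  show ?thesis
  \<comment> \<open>There are four parts, each at level \<open>lam / 4\<close>, whence the factor 4 * 4.\<close>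
  proof (intro exI[of _ "16 * C"] conjI allI impI)
    show "0 \<le> 16 * C" using C by simp
    fix \<mu> :: "(complex ^ 'n) set \<Rightarrow> complex" and lam :: real
    assume \<mu>: "complex_measure torus_borel \<mu>" and lam: "lam > 0"
    let ?S = "{\<eta> \<in> torus. nt_maximal \<alpha> \<beta> A B \<mu> \<eta> > ennreal lam}"
    show "?S \<in> sets torus_haar"
      using nt_maximal_superlevel_measurable[OF assms(1) A \<mu>] lam by simp
    define \<G> :: "(complex \<Rightarrow> real) set" where "\<G> = {Re, \<lambda>w. - Re w, Im, \<lambda>w. - Im w}"
    define \<nu> where "\<nu> g = pos_part_measure torus_borel (\<lambda>X. g (\<mu> X))" for g
    define I where "I g z = (\<integral>\<^sup>+\<zeta>. ennreal (norm (poisson_kernel \<alpha> \<beta> z \<zeta>)) \<partial>\<nu> g)" for g z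
    have \<G>: "finite \<G>" "card \<G> \<le> 4" unfolding \<G>_def by (auto simp: card_insert_if)
    have mass: "emeasure (\<nu> g) torus \<le> total_variation torus_borel \<mu>" if "g \<in> \<G>" for g
      unfolding \<nu>_def
    proof (rule pos_part_measure_mass(2)[OF \<mu>])
      from that consider "g = Re" | "g = (\<lambda>w. - Re w)" | "g = Im" | "g = (\<lambda>w. - Im w)"
        unfolding \<G>_def by blast
      then show "g w \<le> norm w" for w
        by cases (simp_all add: Re_Im_parts_le_norm)
    qed
    define E where "E g = {\<eta> \<in> torus. \<exists>z\<in>restricted_stolz A B \<eta>. ennreal (lam / 4) < I g z}" for g
    have "\<exists>U\<in>sets torus_haar. E g \<subseteq> U \<and>
        emeasure torus_haar U \<le> ennreal (C / (lam / 4)) * emeasure (\<nu> g) torus" for g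
      unfolding E_def I_def using lam by (intro weak) (auto simp: \<nu>_def)
    then obtain U where U: "\<And>g. U g \<in> sets torus_haar"
      "\<And>g. E g \<subseteq> U g"
      "\<And>g. emeasure torus_haar (U g) \<le> ennreal (C / (lam / 4)) * emeasure (\<nu> g) torus" by metis
    have sub: "?S \<subseteq> (\<Union>g\<in>\<G>. U g)"
    proof
      fix \<eta> assume "\<eta> \<in> ?S"
      then obtain z where \<eta>: "\<eta> \<in> torus" and z: "z \<in> restricted_stolz A B \<eta>"
        and big: "ennreal lam < ennreal (norm (poisson_integral \<alpha> \<beta> \<mu> z))"
        by (auto simp: nt_maximal_def less_SUP_iff)
      let ?L = "\<lambda>g. LINT \<zeta>|\<nu> g. poisson_kernel \<alpha> \<beta> z \<zeta>"
      have "norm (poisson_integral \<alpha> \<beta> \<mu> z) \<le>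
          norm (?L Re) + norm (?L (\<lambda>w. - Re w)) + (norm (?L Im) + norm (?L (\<lambda>w. - Im w)))"
        unfolding poisson_integral_def complex_measure_integral_def \<nu>_def
        by (rule order_trans[OF norm_triangle_ineq])
           (auto intro!: add_mono norm_triangle_ineq4 simp: norm_mult)
      then have four: "lam < norm (?L Re) + norm (?L (\<lambda>w. - Re w)) + (norm (?L Im) + norm (?L (\<lambda>w. - Im w)))"
        using big lam by (simp add: ennreal_less_iff)
      have "\<exists>g\<in>\<G>. lam / 4 < norm (?L g)"
      proof (rule ccontr)
        assume "\<not> ?thesis"
        then have "norm (?L g) \<le> lam / 4" if "g \<in> \<G>" for g using that by (meson not_le)
        from this[of Re] this[of "\<lambda>w. - Re w"] this[of Im] this[of "\<lambda>w. - Im w"]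
        show False using four by (simp add: \<G>_def)
      qed
      then obtain g where g: "g \<in> \<G>" "lam / 4 < norm (?L g)" by blast
      have "ennreal (lam / 4) < ennreal (norm (?L g))" using g(2) lam by (simp add: ennreal_less_iff)
      also have "\<dots> \<le> I g z" unfolding I_def by (rule norm_lebesgue_integral_le_nn_integral)
      finally have "\<eta> \<in> E g" unfolding E_def using \<eta> z by blast
      then have "\<eta> \<in> U g" using U(2) by blast
      then show "\<eta> \<in> (\<Union>g\<in>\<G>. U g)" using g(1) by blast
    qed
    have "emeasure torus_haar ?S \<le> emeasure torus_haar (\<Union>g\<in>\<G>. U g)"
      using sub \<G> U(1) by (intro emeasure_mono) auto
    also have "\<dots> \<le> (\<Sum>g\<in>\<G>. emeasure torus_haar (U g))"
      using \<G> U(1) by (intro emeasure_subadditive_finite) auto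
    also have "\<dots> \<le> (\<Sum>g\<in>\<G>. ennreal (C / (lam / 4)) * total_variation torus_borel \<mu>)"
      by (intro sum_mono order_trans[OF U(3)] mult_left_mono mass) auto
    also have "\<dots> \<le> 4 * (ennreal (C / (lam / 4)) * total_variation torus_borel \<mu>)"
      using \<G>(2) by (simp add: mult_right_mono)
    also have "\<dots> = ennreal (16 * C) * total_variation torus_borel \<mu> / ennreal lam"
    proof -
      have "C / (lam / 4) = 4 * C / lam" by simp
      moreover have "(4::ennreal) * ennreal (4 * C / lam) = ennreal (16 * C) / ennreal lam"
        using C lam by (simp add: divide_ennreal ennreal_mult'[symmetric] flip: ennreal_numeral)
      ultimately show ?thesis
        by (metis ennreal_times_divide mult.assoc mult.commute)
    qed
    finally show "emeasure torus_haar ?S \<le> ennreal (16 * C) * total_variation torus_borel \<mu> / ennreal lam" .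
  qed
qed

end
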